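(* Let $r,s\in\mathbb{C}^*$ be roots of unity with $r^2\neq s^2$. Let $\mathcal{N}$ be a simple $U^+_{r,s}(B_2)$-module that is $X_1$-torsion and $X_3$-torsionfree. Then $\mathcal{N}$ is isomorphic to one of the following modules: (1) $\mathcal{M}(\nu)$ for some $\nu=(\nu_1,\nu_2,\nu_3)\in(\mathbb{C}^* )^2\times\mathbb{C}$, if $\mathcal{N}$ is $X_2$-torsionfree; (2) $\mathcal{M}(\xi)$ for some $\xi=(\xi_1,\xi_2)\in\mathbb{C}^*\times\mathbb{C}$, if $\mathcal{N}$ is $X_2$-torsion.
   Context: $U^+_{r,s}(B_2)$ is the unital associative $\mathbb{C}$-algebra generated by $e_1,e_2$ subject to $$e_1^2 e_2-(r^2+s^2)e_1e_2e_1+r^2s^2e_2e_1^2=0,$$ $$e_1e_2^3-(r^2+rs+s^2)e_2e_1e_2^2+rs(r^2+rs+s^2)e_2^2e_1e_2-r^3s^3e_2^3e_1=0.$$ Put $X_1=e_1$, $X_2=e_1e_2-r^2e_2e_1$, $X_3=e_2X_2-s^{-2}X_2e_2$, $X_4=e_2$. These satisfy $$X_1X_2=s^2X_2X_1,\quad X_1X_3=r^2s^2X_3X_1,\quad X_1X_4=r^2X_4X_1+X_2,$$ $$X_2X_3=rsX_3X_2,\quad X_2X_4=s^2X_4X_2-s^2X_3,\quad X_3X_4=rsX_4X_3,$$ and the monomials $X_1^aX_2^bX_3^cX_4^d$ form a basis. All modules are right modules; $\operatorname{ord}(z)$ is the multiplicative order of $z$. For an element $x$, a module is $x$-torsionfree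 if no nonzero vector is annihilated by a power of $x$, and $x$-torsion if every vector is annihilated by a power of $x$ (so that $x$ acts nilpotently on a finite dimensional module). $\mathcal{M}(\nu)$: put $\ell_3=\operatorname{ord}(rs)$, and $m_3=\operatorname{ord}(r^{-2}s^2)$ if $\operatorname{ord}(s^2)\mid\operatorname{ord}(r^{-2}s^2)\operatorname{ord}(rs)$ or $\nu_3=0$, $m_3=2\operatorname{ord}(r^{-2}s^2)$ otherwise. Basis $\{e(a,b):0\le a\le\ell_3-1,\ 0\le b\le m_3-1\}$; action ($\oplus$ modulo $\ell_3$) $$e(a,b)X_1=\begin{cases}-s^{-4(b-1)}(rs)^{-2}(1-r^{-1}s)\frac{1-(r^{-1}s)^{2b}}{1-(r^{-1}s)^2}\nu_1^2e(a\oplus2,b-1),&b\neq0,\\0,&b=0,\end{cases}$$ $$e(a,b)X_2=s^{-2b}\nu_1e(a\oplus1,b),\qquad e(a,b)X_3=(rs)^a\nu_2e(a,b),$$ $$e(a,b)X_4=\begin{cases}\frac{s^{2b}}{s^{-2}-r^{-1}s^{-1}}\left[\nu_1^{-1}e(a\oplus(-1),b+1)-(rs)^{a-1}\nu_1^{-1}\nu_2e(a\oplus(-1),b)\right],&b\neq m_3-1,\\ \frac{s^{2b}}{s^{-2}-r^{-1}s^{-1}}\left[s^{2(a-1)m_3}\nu_1^{-1}\nu_3e(a\oplus(-1),0)-(rs)^{a-1}\nu_1^{-1}\nu_2e(a\oplus(-1),b)\right],&b=m_3-1.\end{cases}$$ $\mathcal{M}(\xi)$: put $\ell_4=\operatorname{lcm}(\operatorname{ord}(rs),\operatorname{ord}(rs^{-1}))$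 if $\xi_2\neq0$, $\ell_4=\operatorname{ord}(rs^{-1})$ if $\xi_2=0$. Basis $\{e(a):0\le a\le\ell_4-1\}$; action $$e(a)X_1=\begin{cases}-r^{-2(a-1)}\frac{1-(rs^{-1})^{a-1}}{1-rs^{-1}}\frac{1-(rs^{-1})^a}{1-(rs^{-1})^2}\xi_1e(a-2),&a\neq0,1,\\0,&a=0,1,\end{cases}$$ $$e(a)X_2=\begin{cases}(rs)^{-(a-1)}\frac{1-(rs^{-1})^a}{1-rs^{-1}}\xi_1e(a-1),&a\neq0,\\0,&a=0,\end{cases}$$ $$e(a)X_3=(rs)^{-a}\xi_1e(a),\qquad e(a)X_4=\begin{cases}e(a+1),&a\neq\ell_4-1,\\ \xi_2e(0),&a=\ell_4-1.\end{cases}$$ *)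

theory Defs
  imports
    "HOL.Complex"
    "HOL-Library.Poly_Mapping"
    "HOL-Library.Function_Algebras"
    "HOL-Algebra.QuotRing"
    "HOL-Algebra.Algebraic_Closure_Type"
begin

section \<open>The free algebra on two generators\<close>

datatype gen = G1 | G2

text \<open>Words form the free monoid, written additively so that the convolution product of
  \<^typ>\<open>'a \<Rightarrow>\<^sub>0 'b\<close> makes the finitely supported functions on words the free algebra.\<close>

datatype word = Word (letters: "gen list")

instantiation word :: monoid_add
begin

definition zero_word :: word where "zero_word = Word []"

definition plus_word :: "word \<Rightarrow> word \<Rightarrow> word"
  where "plus_word u v = Word (letters u @ letters v)"

instance
  by standard (simp_all add: zero_word_def plus_word_def)

end

type_synonym free_alg = "word \<Rightarrow>\<^sub>0 complex"

definition fscal :: "complex \<Rightarrow> free_alg"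
  where "fscal c = Poly_Mapping.single 0 c"

definition f1 :: free_alg where "f1 = Poly_Mapping.single (Word [G1]) 1"

definition f2 :: free_alg where "f2 = Poly_Mapping.single (Word [G2]) 1"

definition free_ring :: "free_alg ring"
  where "free_ring = ring_of_type_algebra"

lemma ring_free_ring: "ring free_ring"
proof -
  have "\<exists>y. x + y = 0" for x :: free_alg
    using add.right_inverse by blast
  then show ?thesis
    unfolding free_ring_def ring_of_type_algebra_def using add.right_inverse
    by unfold_locales (auto simp: algebra_simps Units_def)
qed


section \<open>The algebra $U^+_{r,s}(B_2)$\<close>

definition rel1 :: "complex \<Rightarrow> complex \<Rightarrow> free_alg"
  where "rel1 r s =
    f1^2 * f2 - fscal (r^2 + s^2) * f1 * f2 * f1 + fscal (r^2 * s^2) * f2 * f1^2"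

definition rel2 :: "complex \<Rightarrow> complex \<Rightarrow> free_alg"
  where "rel2 r s =
    f1 * f2^3 - fscal (r^2 + r*s + s^2) * f2 * f1 * f2^2
      + fscal (r*s * (r^2 + r*s + s^2)) * f2^2 * f1 * f2 - fscal (r^3 * s^3) * f2^3 * f1"

definition rel_ideal :: "complex \<Rightarrow> complex \<Rightarrow> free_alg set"
  where "rel_ideal r s = Idl\<^bsub>free_ring\<^esub> {rel1 r s, rel2 r s}"

definition UB2 :: "complex \<Rightarrow> complex \<Rightarrow> free_alg set ring"
  where "UB2 r s = free_ring Quot rel_ideal r s"

lemma ideal_rel_ideal: "ideal (rel_ideal r s) free_ring"
  unfolding rel_ideal_def
  by (rule ring.genideal_ideal[OF ring_free_ring])
    (simp add: free_ring_def ring_of_type_algebra_def)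

lemma ring_UB2: "ring (UB2 r s)"
  unfolding UB2_def by (rule ideal.quotient_is_ring[OF ideal_rel_ideal])

definition cls :: "complex \<Rightarrow> complex \<Rightarrow> free_alg \<Rightarrow> free_alg set"
  where "cls r s p = rel_ideal r s +>\<^bsub>free_ring\<^esub> p"

definition scal :: "complex \<Rightarrow> complex \<Rightarrow> complex \<Rightarrow> free_alg set"
  where "scal r s c = cls r s (fscal c)"

definition f12 :: "complex \<Rightarrow> free_alg"
  where "f12 r = f1 * f2 - fscal (r^2) * f2 * f1"

definition X1 :: "complex \<Rightarrow> complex \<Rightarrow> free_alg set"
  where "X1 r s = cls r s f1"

definition X2 :: "complex \<Rightarrow> complex \<Rightarrow> free_alg set"
  where "X2 r s = cls r s (f12 r)"

definition X3 :: "complex \<Rightarrow> complex \<Rightarrow> free_alg set"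
  where "X3 r s = cls r s (f2 * f12 r - fscal (s powi (-2)) * f12 r * f2)"

definition X4 :: "complex \<Rightarrow> complex \<Rightarrow> free_alg set"
  where "X4 r s = cls r s f2"


section \<open>Right modules\<close>

locale right_module = ring U for U :: "('u, 'b) ring_scheme" (structure) +
  fixes V :: "'v::ab_group_add set" and act :: "'v \<Rightarrow> 'u \<Rightarrow> 'v" (infixl \<open>\<triangleleft>\<close> 70)
  assumes zero_mem: "0 \<in> V"
    and add_mem: "\<lbrakk>v \<in> V; w \<in> V\<rbrakk> \<Longrightarrow> v + w \<in> V"
    and uminus_mem: "v \<in> V \<Longrightarrow> - v \<in> V"
    and act_mem: "\<lbrakk>v \<in> V; x \<in> carrier U\<rbrakk> \<Longrightarrow> v \<triangleleft> x \<in> V"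
    and act_add_left: "\<lbrakk>v \<in> V; w \<in> V; x \<in> carrier U\<rbrakk> \<Longrightarrow> (v + w) \<triangleleft> x = v \<triangleleft> x + w \<triangleleft> x"
    and act_add_right:
      "\<lbrakk>v \<in> V; x \<in> carrier U; y \<in> carrier U\<rbrakk> \<Longrightarrow> v \<triangleleft> (x \<oplus> y) = v \<triangleleft> x + v \<triangleleft> y"
    and act_mult:
      "\<lbrakk>v \<in> V; x \<in> carrier U; y \<in> carrier U\<rbrakk> \<Longrightarrow> v \<triangleleft> (x \<otimes> y) = (v \<triangleleft> x) \<triangleleft> y"
    and act_one: "v \<in> V \<Longrightarrow> v \<triangleleft> \<one> = v"

definition simple_right_module ::
    "('u, 'b) ring_scheme \<Rightarrow> 'v::ab_group_add set \<Rightarrow> ('v \<Rightarrow> 'u \<Rightarrow> 'v) \<Rightarrow> bool"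
  where "simple_right_module U V act \<longleftrightarrow>
    right_module U V act \<and> V \<noteq> {0} \<and>
    (\<forall>W. W \<subseteq> V \<and> right_module U W act \<longrightarrow> W = {0} \<or> W = V)"

definition torsion ::
    "('u, 'b) ring_scheme \<Rightarrow> 'v::ab_group_add set \<Rightarrow> ('v \<Rightarrow> 'u \<Rightarrow> 'v) \<Rightarrow> 'u \<Rightarrow> bool"
  where "torsion U V act x \<longleftrightarrow> (\<forall>v\<in>V. \<exists>k::nat. act v (x [^]\<^bsub>U\<^esub> k) = 0)"

definition torsionfree ::
    "('u, 'b) ring_scheme \<Rightarrow> 'v::ab_group_add set \<Rightarrow> ('v \<Rightarrow> 'u \<Rightarrow> 'v) \<Rightarrow> 'u \<Rightarrow> bool"
  where "torsionfree U V act x \<longleftrightarrow>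
    (\<forall>v\<in>V. v \<noteq> 0 \<longrightarrow> \<not> (\<exists>k::nat. act v (x [^]\<^bsub>U\<^esub> k) = 0))"

definition module_isomorphic ::
    "('u, 'b) ring_scheme \<Rightarrow> 'v::ab_group_add set \<Rightarrow> ('v \<Rightarrow> 'u \<Rightarrow> 'v)
      \<Rightarrow> 'w::ab_group_add set \<Rightarrow> ('w \<Rightarrow> 'u \<Rightarrow> 'w) \<Rightarrow> bool"
  where "module_isomorphic U V act W act' \<longleftrightarrow>
    (\<exists>\<phi>. bij_betw \<phi> V W \<and>
      (\<forall>v\<in>V. \<forall>w\<in>V. \<phi> (v + w) = \<phi> v + \<phi> w) \<and>
      (\<forall>v\<in>V. \<forall>x\<in>carrier U. \<phi> (act v x) = act' (\<phi> v) x))"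


section \<open>The modules $M(\nu)$ and $M(\xi)$\<close>

definition root_of_unity :: "complex \<Rightarrow> bool"
  where "root_of_unity z \<longleftrightarrow> (\<exists>n::nat. n > 0 \<and> z ^ n = 1)"

definition mult_ord :: "complex \<Rightarrow> nat"
  where "mult_ord z = (if root_of_unity z then LEAST n. n > 0 \<and> z ^ n = 1 else 0)"

text \<open>The complex vector space with basis indexed by \<open>I\<close>, for a finite set \<open>I\<close>.\<close>

definition coord_space :: "'i set \<Rightarrow> ('i \<Rightarrow> complex) set"
  where "coord_space I = {v. \<forall>i. i \<notin> I \<longrightarrow> v i = 0}"

definition ebas :: "'i \<Rightarrow> 'i \<Rightarrow> complex"
  where "ebas i = (\<lambda>j. if j = i then 1 else 0)"

definition cscale :: "complex \<Rightarrow> ('i \<Rightarrow> complex) \<Rightarrow> 'i \<Rightarrow> complex"  (infixr \<open>\<cdot>\<^sub>c\<close> 75)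
  where "c \<cdot>\<^sub>c v = (\<lambda>i. c * v i)"

definition coord_module ::
    "complex \<Rightarrow> complex \<Rightarrow> 'i set \<Rightarrow> (('i \<Rightarrow> complex) \<Rightarrow> free_alg set \<Rightarrow> 'i \<Rightarrow> complex) \<Rightarrow> bool"
  where "coord_module r s I act \<longleftrightarrow>
    right_module (UB2 r s) (coord_space I) act \<and>
    (\<forall>v\<in>coord_space I. \<forall>c. act v (scal r s c) = c \<cdot>\<^sub>c v)"

definition ell3 :: "complex \<Rightarrow> complex \<Rightarrow> nat"
  where "ell3 r s = mult_ord (r * s)"

definition m3 :: "complex \<Rightarrow> complex \<Rightarrow> complex \<Rightarrow> nat"
  where "m3 r s \<nu>3 =
    (if mult_ord (s^2) dvd mult_ord (r powi (-2) * s^2) * mult_ord (r * s) \<or> \<nu>3 = 0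
     then mult_ord (r powi (-2) * s^2) else 2 * mult_ord (r powi (-2) * s^2))"

definition shift :: "nat \<Rightarrow> nat \<Rightarrow> int \<Rightarrow> nat"
  where "shift l a k = nat ((int a + k) mod int l)"

definition index_nu :: "complex \<Rightarrow> complex \<Rightarrow> complex \<Rightarrow> (nat \<times> nat) set"
  where "index_nu r s \<nu>3 = {..<ell3 r s} \<times> {..<m3 r s \<nu>3}"

text \<open>\<open>is_M_nu r s \<nu>1 \<nu>2 \<nu>3 act\<close> says that \<open>act\<close> is the module structure of $M(\nu)$ on the
  coordinate space.  It determines \<open>act\<close> on this space, since the prescribed elements
  generate the algebra and the vectors \<open>e a b\<close> form a basis.\<close>

definition is_M_nu ::
    "complex \<Rightarrow> complex \<Rightarrow> complex \<Rightarrow> complex \<Rightarrow> complex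
      \<Rightarrow> ((nat \<times> nat \<Rightarrow> complex) \<Rightarrow> free_alg set \<Rightarrow> nat \<times> nat \<Rightarrow> complex) \<Rightarrow> bool"
  where "is_M_nu r s \<nu>1 \<nu>2 \<nu>3 act \<longleftrightarrow>
    (let l = ell3 r s; m = m3 r s \<nu>3; e = (\<lambda>a b. ebas (a, b)) in
      coord_module r s (index_nu r s \<nu>3) act \<and>
      (\<forall>a<l. \<forall>b<m.
        act (e a b) (X1 r s) =
          (if b \<noteq> 0 then
             (- (s powi (-4 * (int b - 1))) * (r * s) powi (-2) * (1 - inverse r * s)
               * ((1 - (inverse r * s) ^ (2 * b)) / (1 - (inverse r * s)^2)) * \<nu>1^2)
             \<cdot>\<^sub>c e (shift l a 2) (b - 1)
           else 0) \<and>
        act (e a b) (X2 r s) = (s powi (-2 * int b) * \<nu>1) \<cdot>\<^sub>c e (shift l a 1) b \<and>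
        act (e a b) (X3 r s) = ((r * s) ^ a * \<nu>2) \<cdot>\<^sub>c e a b \<and>
        act (e a b) (X4 r s) =
          (s ^ (2 * b) / (s powi (-2) - inverse r * inverse s)) \<cdot>\<^sub>c
            (if b \<noteq> m - 1 then
               inverse \<nu>1 \<cdot>\<^sub>c e (shift l a (-1)) (b + 1)
                 - ((r * s) powi (int a - 1) * inverse \<nu>1 * \<nu>2) \<cdot>\<^sub>c e (shift l a (-1)) b
             else
               (s powi (2 * (int a - 1) * int m) * inverse \<nu>1 * \<nu>3) \<cdot>\<^sub>c e (shift l a (-1)) 0
                 - ((r * s) powi (int a - 1) * inverse \<nu>1 * \<nu>2) \<cdot>\<^sub>c e (shift l a (-1)) b)))"

definition ell4 :: "complex \<Rightarrow> complex \<Rightarrow> complex \<Rightarrow> nat"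
  where "ell4 r s \<xi>2 =
    (if \<xi>2 \<noteq> 0 then lcm (mult_ord (r * s)) (mult_ord (r * inverse s))
     else mult_ord (r * inverse s))"

definition is_M_xi ::
    "complex \<Rightarrow> complex \<Rightarrow> complex \<Rightarrow> complex
      \<Rightarrow> ((nat \<Rightarrow> complex) \<Rightarrow> free_alg set \<Rightarrow> nat \<Rightarrow> complex) \<Rightarrow> bool"
  where "is_M_xi r s \<xi>1 \<xi>2 act \<longleftrightarrow>
    (let l = ell4 r s \<xi>2; e = ebas; q = r * inverse s in
      coord_module r s {..<l} act \<and>
      (\<forall>a<l.
        act (e a) (X1 r s) =
          (if a \<noteq> 0 \<and> a \<noteq> 1 then
             (- (r powi (-2 * (int a - 1))) * ((1 - q ^ (a - 1)) / (1 - q))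
               * ((1 - q ^ a) / (1 - q^2)) * \<xi>1) \<cdot>\<^sub>c e (a - 2)
           else 0) \<and>
        act (e a) (X2 r s) =
          (if a \<noteq> 0 then
             ((r * s) powi (- (int a - 1)) * ((1 - q ^ a) / (1 - q)) * \<xi>1) \<cdot>\<^sub>c e (a - 1)
           else 0) \<and>
        act (e a) (X3 r s) = ((r * s) powi (- int a) * \<xi>1) \<cdot>\<^sub>c e a \<and>
        act (e a) (X4 r s) = (if a \<noteq> l - 1 then e (a + 1) else \<xi>2 \<cdot>\<^sub>c e 0)))"

end

theory Submission
  imports Defs "HOL-Computational_Algebra.Fundamental_Theorem_Algebra"
    "HOL-Analysis.Continuum_Not_Denumerable"
begin

text \<open>
  Put \<open>Z = k X\<^sub>2 X\<^sub>4 + X\<^sub>3\<close> with \<open>k = s\<^sup>-\<^sup>2 - r\<^sup>-\<^sup>1 s\<^sup>-\<^sup>1\<close>.  It commutes with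
  \<open>X\<^sub>3\<close> and q-commutes with \<open>X\<^sub>2\<close> and \<open>X\<^sub>4\<close>.  If \<open>r\<^sup>N = s\<^sup>N = 1\<close>, the \<open>N\<close>-th powers of
  \<open>X\<^sub>2\<close>, \<open>X\<^sub>3\<close>, \<open>X\<^sub>4\<close> and \<open>Z\<close> are central, so by Schur's lemma (in the version for modules of
  countable dimension) they act as scalars, and all these operators have eigenvectors in every
  invariant subspace.  If \<open>X\<^sub>2\<close> is torsionfree, take a
  common eigenvector \<open>w\<close> of \<open>X\<^sub>3\<close>, a power of \<open>X\<^sub>2\<close> and a power of \<open>Z\<close> in the kernel of
  \<open>X\<^sub>1\<close>; the vectors \<open>w X\<^sub>2\<^sup>a Z\<^sup>b\<close> form the basis of $M(\nu)$.  If \<open>X\<^sub>2\<close> is torsion, take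
  \<open>w\<close> in the common kernel of \<open>X\<^sub>1\<close> and \<open>X\<^sub>2\<close>, an eigenvector of \<open>X\<^sub>3\<close> and a power of \<open>X\<^sub>4\<close>; the
  vectors \<open>w X\<^sub>4\<^sup>a\<close> form the basis of $M(\xi)$.  Linear independence holds because these vectors
  are eigenvectors of a few elements of the algebra with jointly distinct eigenvalues.
\<close>

section \<open>Eigenvectors and Schur's lemma\<close>

locale complex_vs = vector_space scale
  for scale :: "complex \<Rightarrow> 'v::ab_group_add \<Rightarrow> 'v" (infixr \<open>*s\<close> 75)
begin

abbreviation lin :: "('v \<Rightarrow> 'v) \<Rightarrow> bool"
  where "lin \<equiv> Vector_Spaces.linear scale scale"

lemma linI:
  assumes "\<And>v w. T (v + w) = T v + T w" "\<And>c v. T (c *s v) = c *s T v"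
  shows "lin T"
  using assms vector_space_axioms by (simp add: Vector_Spaces.linear_iff)

lemma lin_add: "lin T \<Longrightarrow> T (v + w) = T v + T w"
  and lin_scale: "lin T \<Longrightarrow> T (c *s v) = c *s T v"
  by (simp_all add: Vector_Spaces.linear_iff)

lemma lin_zero: "lin T \<Longrightarrow> T 0 = 0"
  using lin_scale[of T 0 0] by simp

lemma lin_neg: "lin T \<Longrightarrow> T (- v) = - T v"
  using lin_scale[of T "-1" v] by simp

lemma lin_diff: "lin T \<Longrightarrow> T (v - w) = T v - T w"
  using lin_add[of T v "- w"] by (simp add: lin_neg)

lemma lin_sum: "lin T \<Longrightarrow> T (\<Sum>i\<in>I. f i) = (\<Sum>i\<in>I. T (f i))"
  by (induction I rule: infinite_finite_induct) (simp_all add: lin_zero lin_add)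

lemmas lin_simps = lin_add lin_scale lin_zero lin_neg lin_diff

lemma lin_funpow: "lin T \<Longrightarrow> lin (T ^^ n)"
  by (induction n) (auto intro!: linI simp: lin_simps)

lemma lin_comp: "lin S \<Longrightarrow> lin T \<Longrightarrow> lin (\<lambda>v. S (T v))"
  by (auto intro!: linI simp: lin_simps)

lemma lin_minus_scalar: "lin T \<Longrightarrow> lin (\<lambda>v. T v - c *s v)"
  by (auto intro!: linI simp: lin_simps algebra_simps)

lemma subspace_kernel_on: "lin T \<Longrightarrow> subspace K \<Longrightarrow> subspace {v \<in> K. T v = 0}"
  unfolding subspace_def by (auto simp: lin_simps)

lemma subspace_eigenspace: "lin T \<Longrightarrow> subspace K \<Longrightarrow> subspace {v \<in> K. T v = c *s v}"
  unfolding subspace_def by (auto simp: lin_simps algebra_simps scale_left_commute)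

lemma subspace_range: "lin T \<Longrightarrow> subspace (range T)"
  unfolding subspace_def
  by (metis (no_types, lifting) lin_add lin_scale lin_zero rangeE rangeI)

lemma funpow_mem: "(\<And>v. v \<in> K \<Longrightarrow> T v \<in> K) \<Longrightarrow> v \<in> K \<Longrightarrow> (T ^^ n) v \<in> K"
  by (induction n) auto

section \<open>Polynomials in an operator, eigenvectors and independence\<close>

definition peval :: "('v \<Rightarrow> 'v) \<Rightarrow> complex poly \<Rightarrow> 'v \<Rightarrow> 'v"
  where "peval T p v = fold_coeffs (\<lambda>a w. a *s v + T w) p 0"

lemma peval_0 [simp]: "peval T 0 v = 0"
  by (simp add: peval_def)

lemma peval_pCons: "lin T \<Longrightarrow> peval T (pCons a p) v = a *s v + T (peval T p v)"
  by (cases "pCons a p = 0") (auto simp: peval_def lin_zero)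

lemma peval_add: "lin T \<Longrightarrow> peval T (p + q) v = peval T p v + peval T q v"
proof (induction p arbitrary: q)
  case (pCons a p)
  show ?case
    by (cases q) (use pCons in \<open>auto simp: peval_pCons lin_simps scale_left_distrib algebra_simps\<close>)
qed auto

lemma peval_smult: "lin T \<Longrightarrow> peval T (smult c p) v = c *s peval T p v"
  by (induction p) (auto simp: peval_pCons lin_simps scale_right_distrib)

lemma peval_diff: "lin T \<Longrightarrow> peval T (p - q) v = peval T p v - peval T q v"
  using peval_add[of T p "smult (-1) q" v] peval_smult[of T "-1" q v] by simp

lemma peval_sum: "lin T \<Longrightarrow> peval T (\<Sum>i\<in>I. f i) v = (\<Sum>i\<in>I. peval T (f i) v)"
  by (induction I rule: infinite_finite_induct) (auto simp: peval_add)

lemma peval_mult: "lin T \<Longrightarrow> peval T (p * q) v = peval T p (peval T q v)"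
  by (induction p) (auto simp: peval_pCons peval_add peval_smult)

lemma lin_peval: "lin T \<Longrightarrow> lin (peval T p)"
  by (induction p) (auto intro!: linI simp: peval_pCons lin_simps algebra_simps scale_left_commute)

lemma peval_linear_factor: "lin T \<Longrightarrow> peval T [:- c, 1:] v = T v - c *s v"
  by (simp add: peval_pCons lin_simps)

lemma peval_monom: "lin T \<Longrightarrow> peval T (monom 1 n) v = (T ^^ n) v"
  by (induction n) (auto simp: monom_Suc peval_pCons lin_simps monom_0)

lemma peval_mem:
  assumes "lin T" "subspace K" "\<And>v. v \<in> K \<Longrightarrow> T v \<in> K" "v \<in> K"
  shows "peval T p v \<in> K"
  using assms by (induction p) (auto simp: peval_pCons subspace_0 subspace_add subspace_scale)

text \<open>A root \<open>c\<close> of the annihilating polynomial splits off a linear factor.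
  Either the cofactor already annihilates \<open>v\<close> and the degree drops, or it maps
  \<open>v\<close> to an eigenvector for \<open>c\<close>.\<close>

lemma eigenvector_of_annihilator:
  assumes "lin T" "subspace K" "\<And>v. v \<in> K \<Longrightarrow> T v \<in> K"
    and "v \<in> K" "v \<noteq> 0" "p \<noteq> 0" "peval T p v = 0"
  shows "\<exists>c. \<exists>w\<in>K. w \<noteq> 0 \<and> T w = c *s w"
  using \<open>p \<noteq> 0\<close> \<open>peval T p v = 0\<close>
proof (induction "degree p" arbitrary: p)
  case 0
  then obtain a where "p = [:a:]" by (metis degree_eq_zeroE)
  then show ?case using 0 assms by (auto simp: peval_pCons lin_simps)
next
  case (Suc n)
  obtain c where "poly p c = 0"
    using alg_closed_imp_poly_has_root[of p] Suc by auto
  then obtain q where q: "p = [:- c, 1:] * q"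
    by (metis poly_eq_0_iff_dvd dvdE)
  have q0: "q \<noteq> 0" using q Suc by auto
  have dq: "degree q = n"
    using Suc(2) q0 unfolding q by (subst (asm) degree_mult_eq) auto
  have T: "T (peval T q v) = c *s peval T q v"
    using Suc.prems(2) assms(1) unfolding q by (simp only: peval_mult peval_linear_factor) simp
  show ?case
  proof (cases "peval T q v = 0")
    case True
    then show ?thesis using Suc.hyps(1)[of q] dq q0 by auto
  next
    case False
    then show ?thesis using T peval_mem[OF assms(1-4), of q] by auto
  qed
qed

lemma eigenvector_of_funpow_scalar:
  assumes "lin T" "subspace K" "\<And>v. v \<in> K \<Longrightarrow> T v \<in> K" "K \<noteq> {0}"
    and "n > 0" "\<And>v. (T ^^ n) v = c *s v"
  obtains a w where "w \<in> K" "w \<noteq> 0" "T w = a *s w"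
proof -
  obtain v where v: "v \<in> K" "v \<noteq> 0" using assms(2,4) subspace_0 by blast
  let ?p = "monom 1 n - [:c:]"
  \<comment> \<open>Here \<open>n > 0\<close> keeps the constant term away from the leading
    coefficient.\<close>
  have "coeff ?p n = 1" using assms(5) by (cases n) auto
  then have "?p \<noteq> 0" by (metis coeff_0 zero_neq_one)
  moreover have "peval T ?p v = 0"
    using assms(1,6) by (simp add: peval_diff peval_monom peval_pCons lin_simps)
  ultimately show ?thesis
    using eigenvector_of_annihilator[OF assms(1-3) v] that by blast
qed

text \<open>If \<open>T - c\<close> were bijective for every \<open>c\<close>, the vectors \<open>(T - c)\<^sup>-\<^sup>1 v\<close> would be uncountably
  many independent elements of a space of countable dimension.\<close>

lemma resolvent_vectors_independent:
  assumes "lin T" "\<And>c w. T w = c *s w \<Longrightarrow> w = 0" "v \<noteq> 0"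
    and u: "\<And>c. T (u c) - c *s u c = v"
    and "finite C" "(\<Sum>c\<in>C. a c *s u c) = 0" "d \<in> C"
  shows "a d = 0"
proof -
  \<comment> \<open>The product of all \<open>T - e\<close> turns the relation into a polynomial in
    \<open>T\<close> applied to \<open>v\<close>. As \<open>T\<close> has no eigenvectors, that
    polynomial is zero. Evaluation at \<open>d\<close> isolates \<open>a d\<close>, as in Lagrange
    interpolation: \<open>P c\<close> has the root \<open>d\<close> for every other
    \<open>c\<close>.\<close>
  define P where "P c = (\<Prod>e\<in>C - {c}. [:- e, 1:])" for c :: complex
  have "(\<Prod>e\<in>C. [:- e, 1:]) = P c * [:- c, 1:]" if "c \<in> C" for c
    using that \<open>finite C\<close> by (simp add: P_def prod.remove mult.commute)
  then have "peval T (\<Prod>e\<in>C. [:- e, 1:]) (u c) = peval T (P c) v" if "c \<in> C" for c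
    using that assms(1) u by (simp only: peval_mult peval_linear_factor)
  then have "(\<Sum>c\<in>C. a c *s peval T (P c) v) = peval T (\<Prod>e\<in>C. [:- e, 1:]) (\<Sum>c\<in>C. a c *s u c)"
    using assms(1) by (simp add: lin_sum[OF lin_peval] lin_scale[OF lin_peval])
  then have "peval T (\<Sum>c\<in>C. smult (a c) (P c)) v = 0"
    using assms(1,6) by (simp add: peval_sum peval_smult lin_zero lin_peval)
  then have "(\<Sum>c\<in>C. smult (a c) (P c)) = 0"
    using eigenvector_of_annihilator[OF assms(1), of UNIV v] assms(2,3) by auto
  then have "(\<Sum>c\<in>C. a c * poly (P c) d) = 0"
    by (metis (no_types, lifting) poly_0 poly_smult poly_sum sum.cong)
  moreover have "poly (P c) d = 0" if "c \<in> C - {d}" for c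
    using that assms(5,7) by (auto simp: P_def poly_prod)
  ultimately have "a d * poly (P d) d = 0"
    using assms(5,7) by (simp add: sum.remove)
  moreover have "poly (P d) d \<noteq> 0"
    using assms(5) by (auto simp: P_def poly_prod)
  ultimately show ?thesis by simp
qed

text \<open>Each resolvent vector lies in the span of one of the countably many finite subsets of
  \<open>A\<close>, and by independence each such span contains only finitely many of them. Without
  an eigenvector the complex numbers would thus be countable.\<close>

lemma countable_span_eigenvalue:
  fixes v :: 'v
  assumes T: "lin T" and A: "countable A" "span A = UNIV" and v: "v \<noteq> 0"
    and surj: "\<And>c. surj (\<lambda>w. T w - c *s w)"
  shows "\<exists>c. \<exists>w. w \<noteq> 0 \<and> T w = c *s w"
proof (rule ccontr)
  assume "\<not> ?thesis"
  then have no: "\<And>c w. T w = c *s w \<Longrightarrow> w = 0" by blast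
  have "\<exists>w. T w - c *s w = v" for c
    using surjD[OF surj[of c], of v] by (metis (no_types))
  then have "\<exists>u. \<forall>c. T (u c) - c *s u c = v" by (intro choice) blast
  then obtain u where u: "\<And>c. T (u c) - c *s u c = v" by blast
  have inj: "inj u"
  proof (rule injI)
    fix c d assume "u c = u d"
    then have "T (u c) - c *s u c = T (u c) - d *s u c" using u[of c] u[of d] by simp
    then have "c *s u c = d *s u c" by simp
    then show "c = d" using u[of c] v T by (auto simp: lin_zero)
  qed
  have "\<exists>B. finite B \<and> B \<subseteq> A \<and> u c \<in> span B" for c
  proof -
    have "u c \<in> span A" using A by simp
    then obtain t q where "finite t" "t \<subseteq> A" "u c = (\<Sum>a\<in>t. q a *s a)"
      unfolding span_explicit by blast
    moreover from this have "u c \<in> span t" by (simp add: span_sum span_scale span_base)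
    ultimately show ?thesis by blast
  qed
  then have "UNIV = (\<Union>B\<in>{B. finite B \<and> B \<subseteq> A}. {c. u c \<in> span B})" by blast
  moreover have "countable {B. finite B \<and> B \<subseteq> A}"
    by (rule countable_Collect_finite_subset[OF A(1)])
  moreover have "finite {c. u c \<in> span B}" if B: "finite B" for B
  proof -
    have "independent (u ` C)" if C: "finite C" for C
    proof (rule independent_if_scalars_zero)
      fix f x assume f: "(\<Sum>x\<in>u ` C. f x *s x) = 0" and x: "x \<in> u ` C"
      then obtain d where d: "d \<in> C" "x = u d" by blast
      have "(\<Sum>c\<in>C. f (u c) *s u c) = 0"
        using f inj by (subst (asm) sum.reindex) (auto simp: inj_on_def)
      then show "f x = 0"
        using resolvent_vectors_independent[of T v u C "\<lambda>c. f (u c)" d] T no v u C d by blast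
    qed (use C in simp)
    then have card: "card C \<le> card B" if "finite C" "C \<subseteq> {c. u c \<in> span B}" for C
      using that independent_span_bound[OF B, of "u ` C"] card_image[OF inj_on_subset[OF inj], of C]
      by auto
    show ?thesis
    proof (rule ccontr)
      assume "infinite {c. u c \<in> span B}"
      then obtain C where "finite C" "card C = Suc (card B)" "C \<subseteq> {c. u c \<in> span B}"
        using infinite_arbitrarily_large by blast
      then show False using card[of C] by simp
    qed
  qed
  ultimately have "countable (UNIV :: complex set)"
    by (metis (no_types, lifting) countable_UN countable_finite mem_Collect_eq)
  then have "countable (complex_of_real ` UNIV)"
    by (rule countable_subset[rotated]) auto
  then have "countable (UNIV :: real set)"
    by (rule countable_image_inj_on) (auto intro: injI)
  then show False using uncountable_UNIV_real by blast
qed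

text \<open>Applying \<open>T - t j\<close> to a relation removes the term of \<open>j\<close> and
  keeps that of \<open>i\<close> up to a nonzero factor. The operator may depend on the pair, so
  several operators can separate the indices jointly.\<close>

lemma separated_eigenvectors_independent:
  assumes "finite I" "\<And>i. i \<in> I \<Longrightarrow> e i \<noteq> 0"
    and sep: "\<And>i j. i \<in> I \<Longrightarrow> j \<in> I \<Longrightarrow> i \<noteq> j \<Longrightarrow>
      \<exists>T t. lin T \<and> (\<forall>k\<in>I. T (e k) = t k *s e k) \<and> t i \<noteq> t j"
    and "(\<Sum>i\<in>I. c i *s e i) = 0" "i \<in> I"
  shows "c i = 0"
  using assms
proof (induction I arbitrary: c i rule: finite_induct)
  case (insert j I)
  have *: "c i = 0" if i: "i \<in> I" for i
  proof -
    have "i \<noteq> j" using i insert.hyps by auto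
    then obtain T t where T: "lin T" "\<forall>k\<in>insert j I. T (e k) = t k *s e k" "t i \<noteq> t j"
      using insert.prems(2)[of i j] i by auto
    have "(\<Sum>k\<in>I. (c k * (t k - t j)) *s e k) = (\<Sum>k\<in>insert j I. (c k * (t k - t j)) *s e k)"
      using insert.hyps by simp
    also have "\<dots> = (\<Sum>k\<in>insert j I. c k *s T (e k)) - (\<Sum>k\<in>insert j I. t j *s c k *s e k)"
      unfolding sum_subtractf[symmetric]
      by (intro sum.cong refl) (use T in \<open>auto simp: algebra_simps scale_left_diff_distrib\<close>)
    also have "\<dots> = T (\<Sum>k\<in>insert j I. c k *s e k) - t j *s (\<Sum>k\<in>insert j I. c k *s e k)"
      using T(1) by (simp only: lin_sum lin_scale scale_sum_right)
    also have "\<dots> = 0" using insert.prems(3) T(1) by (simp add: lin_zero)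
    finally have sum0: "(\<Sum>k\<in>I. (c k * (t k - t j)) *s e k) = 0" .
    have sep: "\<exists>T t. lin T \<and> (\<forall>k\<in>I. T (e k) = t k *s e k) \<and> t i' \<noteq> t j'"
      if "i' \<in> I" "j' \<in> I" "i' \<noteq> j'" for i' j'
      using insert.prems(2)[of i' j'] that by blast
    have "c i * (t i - t j) = 0"
      by (rule insert.IH[OF insert.prems(1) sep sum0 i]) auto
    then show ?thesis using T by simp
  qed
  then have "(\<Sum>k\<in>insert j I. c k *s e k) = c j *s e j"
    using insert.hyps by simp
  then have "c j = 0" using insert.prems(1,3) by auto
  then show ?case using * insert.prems by auto
qed simp

text \<open>A substitute for finite dimension: such an operator satisfies a polynomial X^n - c,
  hence has an eigenvector in every nonzero invariant subspace.\<close>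

definition scalar_power :: "('v \<Rightarrow> 'v) \<Rightarrow> bool"
  where "scalar_power T \<longleftrightarrow> (\<exists>n>0. \<exists>c. \<forall>v. (T ^^ n) v = c *s v)"

lemma scalar_powerI: "n > 0 \<Longrightarrow> (\<And>v. (T ^^ n) v = c *s v) \<Longrightarrow> scalar_power T"
  unfolding scalar_power_def by blast

lemma scalar_power_funpow:
  assumes "scalar_power T"
  shows "scalar_power (T ^^ l)"
proof -
  obtain n c where n: "n > 0" "\<And>v. (T ^^ n) v = c *s v"
    using assms unfolding scalar_power_def by blast
  have "((T ^^ n) ^^ l) v = c ^ l *s v" for v
    by (induction l) (simp_all add: n)
  then show ?thesis
    by (intro scalar_powerI[OF n(1), of _ "c ^ l"]) (simp add: funpow_mult mult.commute)
qed

lemma eigenvector_of_scalar_power: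
  assumes "lin T" "scalar_power T" "subspace K" "\<And>v. v \<in> K \<Longrightarrow> T v \<in> K" "K \<noteq> {0}"
  obtains a w where "w \<in> K" "w \<noteq> 0" "T w = a *s w"
proof -
  obtain n c where n: "n > 0" "\<And>v. (T ^^ n) v = c *s v"
    using assms(2) unfolding scalar_power_def by blast
  show ?thesis by (rule eigenvector_of_funpow_scalar[OF assms(1,3,4,5) n(1,2) that])
qed

end


section \<open>Orders of roots of unity\<close>

lemma root_of_unity_mult: "root_of_unity x \<Longrightarrow> root_of_unity y \<Longrightarrow> root_of_unity (x * y)"
  unfolding root_of_unity_def
proof (elim exE conjE)
  fix n m :: nat
  assume nm: "n > 0" "x ^ n = 1" "m > 0" "y ^ m = 1"
  have "(x * y) ^ (n * m) = (x ^ n) ^ m * (y ^ m) ^ n"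
    by (simp add: power_mult_distrib power_mult[symmetric] mult.commute)
  then show "\<exists>n>0. (x * y) ^ n = 1" using nm by (intro exI[of _ "n * m"]) simp
qed

lemma root_of_unity_inverse: "root_of_unity x \<Longrightarrow> root_of_unity (inverse x)"
  unfolding root_of_unity_def by (auto simp: power_inverse)

lemma root_of_unity_power: "root_of_unity x \<Longrightarrow> root_of_unity (x ^ k)"
  unfolding root_of_unity_def by (auto simp: power_mult[symmetric] mult.commute) (metis power_mult power_one)

lemma mult_ord:
  assumes "root_of_unity x"
  shows mult_ord_pos: "mult_ord x > 0" and power_mult_ord: "x ^ mult_ord x = 1"
  using LeastI_ex[of "\<lambda>n. n > 0 \<and> x ^ n = 1"] assms
  by (auto simp: mult_ord_def root_of_unity_def)

lemma mult_ord_dvd_iff: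
  assumes "root_of_unity x"
  shows "mult_ord x dvd n \<longleftrightarrow> x ^ n = 1"
proof
  assume "mult_ord x dvd n"
  then show "x ^ n = 1" using power_mult_ord[OF assms] by (auto simp: power_mult)
next
  assume n: "x ^ n = 1"
  have "x ^ n = (x ^ mult_ord x) ^ (n div mult_ord x) * x ^ (n mod mult_ord x)"
    by (simp add: power_mult[symmetric] power_add[symmetric])
  then have *: "x ^ (n mod mult_ord x) = 1" using n power_mult_ord[OF assms] by simp
  have "n mod mult_ord x = 0"
  proof (rule ccontr)
    assume "n mod mult_ord x \<noteq> 0"
    then have "mult_ord x \<le> n mod mult_ord x"
      using * assms unfolding mult_ord_def by (auto intro: Least_le)
    then show False using mod_less_divisor[OF mult_ord_pos[OF assms], of n] by simp
  qed
  then show "mult_ord x dvd n" by auto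
qed

lemma root_of_unity_nonzero: "root_of_unity x \<Longrightarrow> x \<noteq> 0"
  by (auto simp: root_of_unity_def zero_power)

lemma power_eq_iff_cong_mult_ord:
  assumes "root_of_unity x"
  shows "x ^ a = x ^ b \<longleftrightarrow> a mod mult_ord x = b mod mult_ord x"
proof -
  have "x ^ a = x ^ b \<longleftrightarrow> mult_ord x dvd (b - a)" if "a \<le> b" for a b
  proof -
    have "x ^ b = x ^ a * x ^ (b - a)" using that by (simp flip: power_add)
    then show ?thesis using root_of_unity_nonzero[OF assms] mult_ord_dvd_iff[OF assms] by auto
  qed
  then show ?thesis
    by (cases "a \<le> b") (metis mod_eq_dvd_iff_nat nat_le_linear)+
qed

lemma mod_lcm_eq:
  fixes i j m n :: nat
  assumes "i mod m = j mod m" "i mod n = j mod n"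
  shows "i mod lcm m n = j mod lcm m n"
proof -
  have "i mod lcm m n = j mod lcm m n" if "i mod m = j mod m" "i mod n = j mod n" "j \<le> i" for i j
    using that by (simp add: mod_eq_dvd_iff_nat lcm_least)
  then show ?thesis using assms by (metis nat_le_linear)
qed


section \<open>Commutation rules\<close>

text \<open>
  Operators are composed in the order opposite to the multiplication of the algebra, which acts from
  the right: \<open>x4 (x1 v)\<close> stands for \<open>v X\<^sub>1 X\<^sub>4\<close>.
\<close>

locale b2_rep = complex_vs scale
  for scale :: "complex \<Rightarrow> 'v::ab_group_add \<Rightarrow> 'v" (infixr \<open>*s\<close> 75) +
  fixes r s :: complex and x1 x2 x3 x4 :: "'v \<Rightarrow> 'v"
  assumes r0: "r \<noteq> 0" and s0: "s \<noteq> 0"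
    and root_r: "root_of_unity r" and root_s: "root_of_unity s" and r2_s2: "r^2 \<noteq> s^2"
    and lin1: "lin x1" and lin2: "lin x2" and lin3: "lin x3" and lin4: "lin x4"
    and R12: "x2 (x1 v) = s^2 *s x1 (x2 v)"
    and R13: "x3 (x1 v) = (r^2 * s^2) *s x1 (x3 v)"
    and R14: "x4 (x1 v) = r^2 *s x1 (x4 v) + x2 v"
    and R23: "x3 (x2 v) = (r * s) *s x2 (x3 v)"
    and R24: "x4 (x2 v) = s^2 *s x2 (x4 v) - s^2 *s x3 v"
    and R34: "x4 (x3 v) = (r * s) *s x3 (x4 v)"
    and simple: "\<lbrakk>subspace W; \<And>v. v \<in> W \<Longrightarrow> x1 v \<in> W; \<And>v. v \<in> W \<Longrightarrow> x4 v \<in> W\<rbrakk>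
      \<Longrightarrow> W = {0} \<or> W = UNIV"
    and nontrivial: "\<exists>v::'v. v \<noteq> 0"
begin

lemmas lins = lin_simps[OF lin1] lin_simps[OF lin2] lin_simps[OF lin3] lin_simps[OF lin4]

lemma r_neq_s: "r \<noteq> s" "r \<noteq> - s"
  using r2_s2 by auto

text \<open>The rules \<open>S..\<close> solve the rules \<open>R..\<close> for the other order. As
  rewrite rules they move the operator of larger index outwards, which sorts monomials into the
  order X_1, X_2, X_3, X_4.\<close>

lemma S14: "x1 (x4 v) = inverse (r^2) *s x4 (x1 v) - inverse (r^2) *s x2 v"
  using r0 by (simp add: R14 scale_right_distrib)

lemma S24: "x2 (x4 v) = inverse (s^2) *s x4 (x2 v) + x3 v"
  using s0 by (simp add: R24 scale_right_diff_distrib)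

lemma S34: "x3 (x4 v) = inverse (r * s) *s x4 (x3 v)"
  using r0 s0 by (simp add: R34 del: inverse_mult_distrib)

lemma S12: "x1 (x2 v) = inverse (s^2) *s x2 (x1 v)"
  using s0 by (simp add: R12)

lemma S13: "x1 (x3 v) = inverse (r^2 * s^2) *s x3 (x1 v)"
  using r0 s0 by (simp add: R13 del: inverse_mult_distrib)

lemma qcomm_funpow:
  assumes "lin A" "lin B" "\<And>v. B (A v) = c *s A (B v)"
  shows "B ((A ^^ n) v) = c ^ n *s (A ^^ n) (B v)"
proof (induction n)
  case (Suc n)
  then show ?case using assms by (simp add: lin_simps)
qed simp

lemma qcomm_funpow_funpow:
  assumes "lin A" "lin B" "\<And>v. B (A v) = c *s A (B v)"
  shows "(B ^^ m) ((A ^^ n) v) = c ^ (m * n) *s (A ^^ n) ((B ^^ m) v)"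
proof (induction m)
  case (Suc m)
  then show ?case using assms qcomm_funpow[OF assms, of n "(B ^^ m) v"]
    by (simp add: lin_simps power_add mult.commute)
qed simp

lemma span_invariant:
  assumes "lin T" "\<And>a. a \<in> A \<Longrightarrow> T a \<in> span A" "v \<in> span A"
  shows "T v \<in> span A"
  using assms(3)
proof (induction rule: span_induct_alt)
  case base
  then show ?case using assms(1) by (simp add: lin_zero span_zero)
next
  case (step c x y)
  then show ?case using assms by (simp add: lin_simps span_add span_scale)
qed

lemma span_eq_UNIV:
  assumes "\<And>a. a \<in> A \<Longrightarrow> x1 a \<in> span A" "\<And>a. a \<in> A \<Longrightarrow> x4 a \<in> span A" "a \<in> A" "a \<noteq> 0"
  shows "span A = UNIV"
  using simple[of "span A"] span_invariant[OF lin1] span_invariant[OF lin4] assms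
    span_base[of a A] by auto

text \<open>Schur's lemma: the range of \<open>T - c\<close> is invariant, so without eigenvectors
  every \<open>T - c\<close> would be surjective, which countable dimension forbids. A nonzero
  eigenspace is invariant too and hence the whole space.\<close>

lemma scalar_of_commuting:
  assumes T: "lin T" and c1: "\<And>v. T (x1 v) = x1 (T v)" and c4: "\<And>v. T (x4 v) = x4 (T v)"
  obtains c where "\<And>v. T v = c *s v"
proof -
  obtain v0 :: 'v where v0: "v0 \<noteq> 0" using nontrivial by blast
  \<comment> \<open>All vectors obtained from \<open>v0\<close> by words in \<open>x1\<close> and
    \<open>x4\<close>: a countable set that spans by simplicity.\<close>
  define A where "A = range (\<lambda>l. foldr (\<lambda>b. if b then x1 else x4) l v0)"
  have "x1 a \<in> A \<and> x4 a \<in> A" if a: "a \<in> A" for a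
  proof -
    obtain l where l: "a = foldr (\<lambda>b. if b then x1 else x4) l v0" using a by (auto simp: A_def)
    have "x1 a = foldr (\<lambda>b. if b then x1 else x4) (True # l) v0"
      "x4 a = foldr (\<lambda>b. if b then x1 else x4) (False # l) v0" by (simp_all add: l)
    then show ?thesis unfolding A_def by blast
  qed
  moreover have "v0 \<in> A" unfolding A_def by (rule range_eqI[of _ _ "[]"]) simp
  ultimately have span: "span A = UNIV" using v0 by (intro span_eq_UNIV) (auto intro: span_base)
  have "\<exists>c w. w \<noteq> 0 \<and> T w = c *s w"
  proof (rule ccontr)
    assume no: "\<not> ?thesis"
    have surj: "surj (\<lambda>w. T w - c *s w)" for c
    proof -
      let ?S = "\<lambda>w. T w - c *s w"
      have "range ?S = {0} \<or> range ?S = UNIV"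
      proof (rule simple)
        show "subspace (range ?S)" by (rule subspace_range[OF lin_minus_scalar[OF T]])
        fix v assume "v \<in> range ?S"
        then obtain u where u: "v = ?S u" by blast
        have "x1 v = ?S (x1 u)" "x4 v = ?S (x4 u)" by (simp_all add: u lins c1 c4)
        then show "x1 v \<in> range ?S" "x4 v \<in> range ?S" by blast+
      qed
      moreover have "?S v0 \<noteq> 0" using no v0 by auto
      ultimately show ?thesis by blast
    qed
    have "countable A" by (simp add: A_def)
    then show False using countable_span_eigenvalue[OF T _ span v0 surj] no by blast
  qed
  then obtain c w where w: "w \<noteq> 0" "T w = c *s w" by blast
  have "{v \<in> UNIV. T v = c *s v} = {0} \<or> {v \<in> UNIV. T v = c *s v} = UNIV"
    by (rule simple[OF subspace_eigenspace[OF T subspace_UNIV]]) (auto simp: c1 c4 lins)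
  then have "T v = c *s v" for v using w by blast
  then show ?thesis using that by blast
qed

lemma common_period: obtains N where "N > 0" "r ^ N = 1" "s ^ N = 1"
proof -
  obtain n m where "n > 0" "r ^ n = 1" "m > 0" "s ^ m = 1"
    using root_r root_s by (auto simp: root_of_unity_def)
  then show ?thesis using that[of "n * m"] by (simp add: power_mult) (metis mult.commute power_mult power_one)
qed

section \<open>The q-commuting element Z\<close>

definition k where "k = s powi (-2) - inverse r * inverse s"

definition z where "z v = k *s x4 (x2 v) + x3 v"

lemma k0: "k \<noteq> 0"
  using r_neq_s r0 s0 by (auto simp: k_def power_int_minus power2_eq_square field_simps)

lemma linz: "lin z"
  by (rule linI) (simp_all add: z_def lins algebra_simps)

lemma x4_x2: "x4 (x2 v) = inverse k *s (z v - x3 v)"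
  using k0 by (simp add: z_def)

text \<open>The constant \<open>k\<close> is made for this:
  \<open>k + inverse (r * s) = inverse (s^2)\<close> gives the \<open>x3\<close> term the same
  factor as the \<open>x4\<close> term. The same identity yields \<open>z_x4\<close>.\<close>

lemma x2_z: "x2 (z v) = inverse (s^2) *s z (x2 v)"
proof -
  have "x2 (z v) = (k * inverse (s^2)) *s x4 (x2 (x2 v)) + (k + inverse (r * s)) *s x3 (x2 v)"
    using r0 s0 by (simp add: z_def lins S24 R23 scale_right_distrib scale_left_distrib distrib_right
        del: inverse_mult_distrib)
  also have "k + inverse (r * s) = inverse (s^2)"
    by (simp add: k_def power_int_minus)
  finally show ?thesis by (simp add: z_def scale_right_distrib mult.commute)
qed

lemma x3_z: "x3 (z v) = z (x3 v)"
  using r0 s0 by (simp add: z_def lins S34 R23 field_simps)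

text \<open>The defect in \<open>x2 (x2 v)\<close> is the source of the action of X_1 on M(\<nu>),
  which lowers the exponent of Z by one and raises that of X_2 by two.\<close>

lemma x1_z: "x1 (z v) = inverse ((r * s)^2) *s z (x1 v) - (inverse (r^2) * k) *s x2 (x2 v)"
proof -
  have "x1 (z v) = (k * inverse (r^2) * inverse (s^2)) *s x4 (x2 (x1 v))
      - (k * inverse (r^2)) *s x2 (x2 v) + inverse (r^2 * s^2) *s x3 (x1 v)"
    by (simp add: z_def lins S14 S12 S13 scale_right_diff_distrib mult.assoc)
  then show ?thesis
    by (simp add: z_def scale_right_distrib power_mult_distrib mult_ac)
qed

lemma z_x4: "z (x4 v) = inverse (s^2) *s x4 (z v)"
proof -
  have "z (x4 v) = (k * inverse (s^2)) *s x4 (x4 (x2 v)) + (k + inverse (r * s)) *s x4 (x3 v)"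
    by (simp add: z_def lins S24 S34 scale_right_distrib scale_left_distrib add.assoc)
  also have "k + inverse (r * s) = inverse (s^2)"
    by (simp add: k_def power_int_minus)
  finally show ?thesis by (simp add: z_def lins scale_right_distrib mult.commute)
qed

definition q where "q = r * inverse s"

lemma q0: "q \<noteq> 0" and q1: "q \<noteq> 1" and q2: "q^2 \<noteq> 1"
  using r_neq_s r0 s0 r2_s2 by (auto simp: q_def field_simps)

text \<open>
  The coefficients in the rules for moving \<open>X\<^sub>1\<close> and \<open>X\<^sub>2\<close> past a power of \<open>X\<^sub>4\<close>, a power of \<open>X\<^sub>2\<close>
  past \<open>X\<^sub>4\<close>, and \<open>X\<^sub>1\<close> past a power of \<open>Z\<close>.  In those rules the truncated exponents \<open>n - 1\<close> and
  \<open>n - 2\<close> are harmless, because the coefficients vanish where truncation occurs.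
\<close>

definition d where "d n = (r * s) powi (- (int n - 1)) * ((1 - q ^ n) / (1 - q))"
definition g where "g n = - (r powi (-2 * (int n - 1))) * ((1 - q ^ (n - 1)) / (1 - q)) * ((1 - q ^ n) / (1 - q^2))"
definition h where
  "h n = inverse (r^2) * (inverse (r^2) ^ n - inverse (s^2) ^ n) / (inverse (r^2) - inverse (s^2))"
definition f where "f n = s^2 * ((r * s) ^ n - (s^2) ^ n) / (r * s - s^2)"
definition C where "C n = s powi (-4 * (int n - 1)) * ((1 - (inverse r * s) ^ (2 * n)) / (1 - (inverse r * s)^2))"

lemma d_0: "d 0 = 0" by (simp add: d_def)

text \<open>This is the recursion that \<open>S24\<close> and \<open>x3_pow4\<close> produce in
  \<open>x2_pow4\<close>. Since \<open>inverse (s^2) * (r * s) = q\<close>, its solution is a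
  geometric sum in \<open>q\<close>.\<close>

lemma d_Suc: "d (Suc n) = inverse (s^2) * d n + inverse (r * s) ^ n"
proof -
  \<comment> \<open>This form of the power is valid for \<open>n = 0\<close> as well.\<close>
  have "w powi (- (int n - 1)) = w * inverse w ^ n" if "w \<noteq> 0" for w :: complex
    using that by (simp add: power_int_diff power_inverse field_simps)
  then have dn: "d n = (r * s) * inverse (r * s) ^ n * ((1 - q ^ n) / (1 - q))"
    unfolding d_def using r0 s0 by simp
  have dS: "d (Suc n) = inverse (r * s) ^ n * ((1 - q ^ Suc n) / (1 - q))"
    by (simp add: d_def power_int_minus power_inverse del: inverse_mult_distrib power_Suc)
  have i: "inverse (s^2) * (r * s) = q" using s0 by (simp add: q_def power2_eq_square field_simps)
  have "inverse (s^2) * d n = (inverse (s^2) * (r * s)) * (inverse (r * s) ^ n * ((1 - q ^ n) / (1 - q)))"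
    by (simp only: dn mult.assoc)
  also have "\<dots> = inverse (r * s) ^ n * (q * ((1 - q ^ n) / (1 - q)))"
    unfolding i by (simp only: mult_ac)
  also have "\<dots> + inverse (r * s) ^ n = inverse (r * s) ^ n * (q * ((1 - q ^ n) / (1 - q)) + 1)"
    by (simp only: distrib_left mult_1_right)
  also have "q * ((1 - q ^ n) / (1 - q)) + 1 = (1 - q ^ Suc n) / (1 - q)"
    using q1 by (simp add: field_simps)
  finally show ?thesis using dS by simp
qed

lemma g_0: "g 0 = 0" and g_1: "g (Suc 0) = 0" by (simp_all add: g_def)

text \<open>By \<open>inverse (r * s) = inverse (r^2) * q\<close> all terms share a power of
  \<open>inverse (r^2)\<close>, and what remains is
  \<open>1 - q^m + q^m * (1 - q^2) = 1 - q^(m+2)\<close>. The case \<open>n = 0\<close> is separate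
  because the exponent \<open>n - 1\<close> is truncated there.\<close>

lemma g_Suc: "g (Suc n) = inverse (r^2) * (g n - d n)"
proof (cases n)
  case (Suc m)
  have rs: "inverse (r * s) = inverse (r^2) * q" using r0 s0 by (simp add: q_def power2_eq_square field_simps)
  have dn: "d n = inverse (r^2) ^ m * q ^ m * ((1 - q ^ Suc m) / (1 - q))"
    unfolding power_mult_distrib[symmetric] rs[symmetric]
    using Suc by (simp add: d_def power_int_minus power_inverse del: inverse_mult_distrib power_Suc)
  have gn: "g n = - (inverse (r^2) ^ m) * ((1 - q ^ m) / (1 - q)) * ((1 - q ^ Suc m) / (1 - q^2))"
    using Suc by (simp add: g_def power_int_minus power_inverse power_int_mult)
  have gS: "g (Suc n) = - (inverse (r^2) ^ Suc m) * ((1 - q ^ Suc m) / (1 - q)) * ((1 - q ^ Suc (Suc m)) / (1 - q^2))"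
  proof -
    have "r powi (-2 * (int (Suc n) - 1)) = r powi (-2 * int (Suc m))" using Suc by simp
    also have "\<dots> = (r powi (-2)) powi int (Suc m)" by (rule power_int_mult)
    also have "r powi (-2) = inverse (r^2)" by (simp add: power_int_minus)
    also have "inverse (r^2) powi int (Suc m) = inverse (r^2) ^ Suc m" by (rule power_int_of_nat)
    finally have e: "r powi (-2 * (int (Suc n) - 1)) = inverse (r^2) ^ Suc m" .
    show ?thesis unfolding g_def e unfolding Suc by simp
  qed
  have frac: "A / u * (B / w) + y * (B / u) = B / u * (D / w)"
    if "w \<noteq> 0" "A + y * w = D" for A B D u w y :: complex
  proof -
    have "D / w = A / w + y" using that by (simp add: add_divide_distrib flip: that(2))
    then show ?thesis by (simp add: distrib_left mult.commute)
  qed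
  have "((1 - q ^ m) / (1 - q)) * ((1 - q ^ Suc m) / (1 - q^2)) + q ^ m * ((1 - q ^ Suc m) / (1 - q))
      = ((1 - q ^ Suc m) / (1 - q)) * ((1 - q ^ Suc (Suc m)) / (1 - q^2))"
    by (rule frac) (use q2 in \<open>simp_all add: algebra_simps power2_eq_square\<close>)
  moreover have "- (a ^ Suc m) * D * G = a * (- (a ^ m) * A * B - a ^ m * y * D)"
    if "A * B + y * D = D * G" for a A B y D G :: complex
  proof -
    have "- (a ^ Suc m) * (D * G) = a * (- (a ^ m) * A * B - a ^ m * y * D)"
      unfolding that[symmetric] by (simp add: algebra_simps)
    then show ?thesis by (simp only: mult.assoc)
  qed
  ultimately show ?thesis unfolding dn gn gS by blast
qed (simp add: d_0 g_0 g_1)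

lemma h_0: "h 0 = 0" by (simp add: h_def)

lemma h_Suc: "h (Suc n) = inverse (r^2) * (h n + inverse (s^2) ^ n)"
proof -
  define a b where ab: "a = inverse (r^2)" "b = inverse (s^2)"
  then have "a - b \<noteq> 0" using r2_s2 by simp
  then have "a * (a ^ n - b ^ n) / (a - b) + b ^ n = (a * (a ^ n - b ^ n) + b ^ n * (a - b)) / (a - b)"
    by (simp add: add_divide_distrib)
  also have "a * (a ^ n - b ^ n) + b ^ n * (a - b) = a ^ Suc n - b ^ Suc n" by (simp add: algebra_simps)
  finally show ?thesis unfolding h_def ab[symmetric] by simp
qed

lemma f_0: "f 0 = 0" by (simp add: f_def)

lemma f_Suc: "f (Suc n) = s^2 * (f n + (r * s) ^ n)"
proof -
  have "r * s - s^2 \<noteq> 0" using r_neq_s s0 by (simp add: power2_eq_square)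
  then have "f n + (r * s) ^ n = (s^2 * ((r * s) ^ n - (s^2) ^ n) + (r * s) ^ n * (r * s - s^2)) / (r * s - s^2)"
    by (simp add: f_def add_divide_distrib)
  also have "s^2 * ((r * s) ^ n - (s^2) ^ n) + (r * s) ^ n * (r * s - s^2) = (r * s) ^ Suc n - (s^2) ^ Suc n"
    by (simp add: algebra_simps)
  finally show ?thesis unfolding f_def by simp
qed

lemma C_0: "C 0 = 0" by (simp add: C_def)

text \<open>Up to a power of \<open>s\<close>, \<open>C n\<close> is a geometric sum in
  \<open>?Q\<close>, because \<open>inverse ((r * s)^2) = inverse (s^4) * ?Q\<close>.\<close>

lemma C_Suc: "C (Suc n) = inverse ((r * s)^2) ^ n + inverse (s^2) ^ 2 * C n"
proof -
  let ?Q = "(inverse r * s)^2"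
  have Q1: "?Q \<noteq> 1" using r2_s2 r0 by (simp add: power_mult_distrib field_simps)
  have i: "inverse ((r * s)^2) = inverse (s^4) * ?Q"
    using r0 s0 by (simp add: power_mult_distrib field_simps)
  have c': "C (Suc n) = inverse (s^4) ^ n * ((1 - ?Q ^ Suc n) / (1 - ?Q))"
    unfolding power_mult[symmetric]
    by (simp add: C_def power_int_minus power_inverse power_int_mult del: power_Suc mult_Suc_right)
  have c: "inverse (s^2) ^ 2 * C n = inverse (s^4) ^ n * ((1 - ?Q ^ n) / (1 - ?Q))"
  proof -
    have "s powi (-4 * (int n - 1)) = (s powi (- 4)) powi (int n - 1)" by (rule power_int_mult)
    also have "s powi (- 4) = inverse (s^4)" by (simp add: power_int_minus)
    also have "inverse (s^4) powi (int n - 1) = inverse (s^4) ^ n * s^4"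
      using s0 by (simp add: power_int_diff field_simps)
    finally show ?thesis using s0 by (simp add: C_def power_mult power_inverse)
  qed
  have "(1 - Q ^ Suc n) / (1 - Q) = Q ^ n + (1 - Q ^ n) / (1 - Q)" if "Q \<noteq> 1" for Q :: complex
    using that by (simp add: field_simps)
  from this[OF Q1] have "(1 - ?Q ^ Suc n) / (1 - ?Q) = ?Q ^ n + (1 - ?Q ^ n) / (1 - ?Q)" .
  then show ?thesis unfolding c c' i by (simp add: power_mult_distrib algebra_simps)
qed

lemma x3_pow4: "x3 ((x4 ^^ n) v) = inverse (r * s) ^ n *s (x4 ^^ n) (x3 v)"
  by (rule qcomm_funpow[OF lin4 lin3 S34])

lemma x2_pow4: "x2 ((x4 ^^ n) v) = inverse (s^2) ^ n *s (x4 ^^ n) (x2 v) + d n *s (x4 ^^ (n - 1)) (x3 v)"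
proof (induction n)
  case (Suc n)
  have 1: "d n *s x4 ((x4 ^^ (n - 1)) (x3 v)) = d n *s (x4 ^^ n) (x3 v)"
    by (cases n) (simp_all add: d_0)
  have "x2 ((x4 ^^ Suc n) v) = inverse (s^2) *s x4 (x2 ((x4 ^^ n) v)) + x3 ((x4 ^^ n) v)"
    by (simp add: S24)
  also have "\<dots> = (inverse (s^2) * inverse (s^2) ^ n) *s (x4 ^^ Suc n) (x2 v)
      + (inverse (s^2) * d n + inverse (r * s) ^ n) *s (x4 ^^ n) (x3 v)"
    unfolding Suc x3_pow4 lin_simps[OF lin4] 1 scale_right_distrib scale_left_distrib scale_scale
    by (simp only: add_ac funpow.simps o_apply)
  finally show ?case by (simp add: d_Suc)
qed (simp add: d_0)

lemma x1_pow4: "x1 ((x4 ^^ n) v) = inverse (r^2) ^ n *s (x4 ^^ n) (x1 v)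
    - h n *s (x4 ^^ (n - 1)) (x2 v) + g n *s (x4 ^^ (n - 2)) (x3 v)"
proof (induction n)
  case (Suc n)
  have 1: "h n *s x4 ((x4 ^^ (n - 1)) (x2 v)) = h n *s (x4 ^^ n) (x2 v)"
    by (cases n) (simp_all add: h_0)
  have 2: "g n *s x4 ((x4 ^^ (n - 2)) (x3 v)) = g n *s (x4 ^^ (n - 1)) (x3 v)"
  proof (cases "n < 2")
    case True
    then have "n = 0 \<or> n = 1" by auto
    then show ?thesis by (auto simp: g_0 g_1)
  next
    case False
    then have "n - 1 = Suc (n - 2)" by simp
    then show ?thesis by simp
  qed
  have x4x1: "x4 (x1 ((x4 ^^ n) v)) = inverse (r^2) ^ n *s (x4 ^^ Suc n) (x1 v)
      - h n *s (x4 ^^ n) (x2 v) + g n *s (x4 ^^ (n - 1)) (x3 v)"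
    unfolding Suc lin_simps[OF lin4] 1 2 by simp
  have "x1 ((x4 ^^ Suc n) v) = inverse (r^2) *s x4 (x1 ((x4 ^^ n) v)) - inverse (r^2) *s x2 ((x4 ^^ n) v)"
    by (simp add: S14)
  also have "\<dots> = (inverse (r^2) * inverse (r^2) ^ n) *s (x4 ^^ Suc n) (x1 v)
      - (inverse (r^2) * (h n + inverse (s^2) ^ n)) *s (x4 ^^ n) (x2 v)
      + (inverse (r^2) * (g n - d n)) *s (x4 ^^ (n - 1)) (x3 v)"
    unfolding x4x1 x2_pow4 scale_right_distrib scale_right_diff_distrib distrib_left
      right_diff_distrib scale_left_distrib scale_left_diff_distrib scale_scale
    by (simp only: diff_conv_add_uminus minus_add_distrib add_ac)
  finally show ?case by (simp add: h_Suc g_Suc)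
qed (simp add: g_0 h_0)

lemma x4_pow2: "x4 ((x2 ^^ n) v) = (s^2) ^ n *s (x2 ^^ n) (x4 v) - f n *s (x2 ^^ (n - 1)) (x3 v)"
proof (induction n)
  case (Suc n)
  have 1: "f n *s x2 ((x2 ^^ (n - 1)) (x3 v)) = f n *s (x2 ^^ n) (x3 v)"
    by (cases n) (simp_all add: f_0)
  have "x4 ((x2 ^^ Suc n) v) = s^2 *s x2 (x4 ((x2 ^^ n) v)) - s^2 *s x3 ((x2 ^^ n) v)"
    by (simp add: R24)
  also have "\<dots> = (s^2 * (s^2) ^ n) *s (x2 ^^ Suc n) (x4 v) - (s^2 * (f n + (r * s) ^ n)) *s (x2 ^^ n) (x3 v)"
    unfolding Suc qcomm_funpow[OF lin2 lin3 R23] lin_simps[OF lin2] 1 scale_right_diff_distrib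
      distrib_left scale_left_distrib scale_scale
    by (simp only: diff_conv_add_uminus minus_add_distrib add_ac funpow.simps o_apply)
  finally show ?case by (simp add: f_Suc)
qed (simp add: f_0)

text \<open>The induction takes off the innermost factor: the hypothesis is applied to
  \<open>z v\<close>, and moving \<open>x2\<close> twice past that \<open>z\<close> costs the factor
  \<open>inverse (s^2) ^ 2\<close> of the recursion \<open>C_Suc\<close>.\<close>

lemma x1_powz: "x1 ((z ^^ n) v) = inverse ((r * s)^2) ^ n *s (z ^^ n) (x1 v)
    - (inverse (r^2) * k * C n) *s (z ^^ (n - 1)) (x2 (x2 v))"
proof (induction n arbitrary: v)
  case (Suc n)
  let ?K = "inverse (r^2) * k"
  have zz: "x2 (x2 (z v)) = inverse (s^2) ^ 2 *s z (x2 (x2 v))"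
    by (simp add: x2_z lins power2_eq_square)
  have 1: "C n *s (z ^^ (n - 1)) (z (x2 (x2 v))) = C n *s (z ^^ n) (x2 (x2 v))"
    by (cases n) (simp_all add: C_0 funpow_swap1)
  have "x1 ((z ^^ Suc n) v) = x1 ((z ^^ n) (z v))" by (simp add: funpow_swap1)
  also have "\<dots> = inverse ((r * s)^2) ^ n *s (z ^^ n) (x1 (z v))
     - (?K * inverse (s^2) ^ 2) *s C n *s (z ^^ (n - 1)) (z (x2 (x2 v)))"
    by (simp only: Suc zz lin_scale[OF lin_funpow[OF linz]] scale_scale) (simp add: mult_ac)
  also have "\<dots> = inverse ((r * s)^2) ^ Suc n *s (z ^^ Suc n) (x1 v)
      - (?K * C (Suc n)) *s (z ^^ n) (x2 (x2 v))"
    unfolding 1 by (simp add: x1_z lin_simps[OF lin_funpow[OF linz]] C_Suc funpow_swap1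
        scale_right_diff_distrib scale_left_distrib algebra_simps)
  finally show ?case by simp
qed (simp add: C_0)


subsection \<open>Central powers\<close>

text \<open>At a common period \<open>N\<close> of \<open>r\<close> and \<open>s\<close> the
  correction coefficients vanish and the q-commutation factors become 1. The powers then commute
  with the two generators, and \<open>scalar_of_commuting\<close> applies.\<close>

lemma
  shows scalar_power_x2: "scalar_power x2" and scalar_power_x3: "scalar_power x3"
    and scalar_power_x4: "scalar_power x4" and scalar_power_z: "scalar_power z"
proof -
  obtain N where N: "N > 0" "r ^ N = 1" "s ^ N = 1" by (rule common_period)
  have pN: "(r ^ i) ^ N = 1" "(s ^ i) ^ N = 1" for i
    using N by (metis power_mult mult.commute power_one)+
  note N' = power_mult_distrib N pN power_inverse
  have qN: "q ^ N = 1" by (simp add: q_def N')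
  have "d N = 0" "f N = 0" "h N = 0" by (simp_all add: d_def f_def h_def N' qN)
  have "g N = 0" by (simp add: g_def qN)
  have "(inverse r * s) ^ (2 * N) = 1" by (simp add: N' power_mult)
  then have "C N = 0" by (simp add: C_def)
  have z_x1: "(z ^^ N) (x1 v) = x1 ((z ^^ N) v)" for v
    using x1_powz[of N v] \<open>C N = 0\<close> by (simp add: N')
  have z_x4: "(z ^^ N) (x4 v) = x4 ((z ^^ N) v)" for v
    using qcomm_funpow_funpow[OF lin4 linz z_x4, of N 1 v] by (simp add: N')
  have x4_x1: "(x4 ^^ N) (x1 v) = x1 ((x4 ^^ N) v)" for v
    using x1_pow4[of N v] \<open>h N = 0\<close> \<open>g N = 0\<close> by (simp add: N')
  have x4_x4: "(x4 ^^ N) (x4 v) = x4 ((x4 ^^ N) v)" for v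
    by (simp add: funpow_swap1)
  have x2_x4: "(x2 ^^ N) (x4 v) = x4 ((x2 ^^ N) v)" for v
    using x4_pow2[of N v] \<open>f N = 0\<close> by (simp add: N')
  have x2_x1: "(x2 ^^ N) (x1 v) = x1 ((x2 ^^ N) v)" for v
    using qcomm_funpow_funpow[OF lin1 lin2 R12, of N 1 v] by (simp add: N')
  have x3_x1: "(x3 ^^ N) (x1 v) = x1 ((x3 ^^ N) v)" for v
    using qcomm_funpow_funpow[OF lin1 lin3 R13, of N 1 v] by (simp add: N')
  have x3_x4: "(x3 ^^ N) (x4 v) = x4 ((x3 ^^ N) v)" for v
    using qcomm_funpow_funpow[OF lin4 lin3 S34, of N 1 v] by (simp add: N')
  show "scalar_power x2"
    by (rule scalar_of_commuting[OF lin_funpow[OF lin2] x2_x1 x2_x4]) (rule scalar_powerI[OF N(1)])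
  show "scalar_power x3"
    by (rule scalar_of_commuting[OF lin_funpow[OF lin3] x3_x1 x3_x4]) (rule scalar_powerI[OF N(1)])
  show "scalar_power x4"
    by (rule scalar_of_commuting[OF lin_funpow[OF lin4] x4_x1 x4_x4]) (rule scalar_powerI[OF N(1)])
  show "scalar_power z"
    by (rule scalar_of_commuting[OF lin_funpow[OF linz] z_x1 z_x4]) (rule scalar_powerI[OF N(1)])
qed

text \<open>Some power of \<open>x2\<close> is a scalar \<open>c\<close>. If \<open>c = 0\<close>,
  everything is torsion; otherwise \<open>x2\<close> is injective.\<close>

lemma torsion_dichotomy_x2:
  "(\<forall>v. v \<noteq> 0 \<longrightarrow> \<not> (\<exists>n. (x2 ^^ n) v = 0)) \<or> (\<forall>v. \<exists>n. (x2 ^^ n) v = 0)"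
proof -
  obtain n c where n: "n > 0" "\<And>v. (x2 ^^ n) v = c *s v"
    using scalar_power_x2 unfolding scalar_power_def by blast
  show ?thesis
  proof (cases "c = 0")
    case True
    then show ?thesis using n by (metis scale_zero_left)
  next
    case False
    have "x2 v \<noteq> 0" if "v \<noteq> 0" for v
    proof
      assume "x2 v = 0"
      then have "(x2 ^^ Suc (n - 1)) v = 0"
        by (simp add: funpow_swap1 lin_zero[OF lin_funpow[OF lin2]])
      then show False using n that False by simp
    qed
    then have "(x2 ^^ m) v \<noteq> 0" if "v \<noteq> 0" for m v using that by (induction m) auto
    then show ?thesis by blast
  qed
qed

text \<open>The last nonzero iterate of any nonzero vector of \<open>K\<close> lies in the
  kernel.\<close>

lemma nonzero_kernel_of_torsion:
  assumes "K \<noteq> {0}" "subspace K" "\<And>v. v \<in> K \<Longrightarrow> T v \<in> K" "\<And>v. \<exists>n. (T ^^ n) v = 0"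
  shows "{v \<in> K. T v = 0} \<noteq> {0}"
proof -
  obtain v where v: "v \<in> K" "v \<noteq> 0" using assms(1,2) subspace_0 by blast
  define n where "n = (LEAST n. (T ^^ n) v = 0)"
  have n: "(T ^^ n) v = 0" unfolding n_def using assms(4) by (rule LeastI_ex)
  then obtain m where m: "n = Suc m" using v by (cases n) auto
  have "(T ^^ m) v \<noteq> 0" using not_less_Least[of m "\<lambda>n. (T ^^ n) v = 0"] m unfolding n_def by auto
  moreover have "(T ^^ m) v \<in> K" by (rule funpow_mem[OF assms(3) v(1)])
  ultimately show ?thesis using n m by auto
qed

definition ker1 where "ker1 = {v. x1 v = 0}"

definition ker12 where "ker12 = {v \<in> ker1. x2 v = 0}"

lemma subspace_ker1: "subspace ker1"
  using subspace_kernel_on[OF lin1 subspace_UNIV] by (simp add: ker1_def)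

lemma subspace_ker12: "subspace ker12"
  using subspace_kernel_on[OF lin2 subspace_ker1] by (simp add: ker12_def)

lemma x2_ker1: "v \<in> ker1 \<Longrightarrow> x2 v \<in> ker1" and x3_ker1: "v \<in> ker1 \<Longrightarrow> x3 v \<in> ker1"
  by (simp_all add: ker1_def S12 S13 lins)

lemma x3_ker12: "v \<in> ker12 \<Longrightarrow> x3 v \<in> ker12"
  using R23[of v] r0 s0 by (simp add: ker12_def x3_ker1 lins)

lemma ker1_nonzero:
  assumes "\<And>v. \<exists>n. (x1 ^^ n) v = 0"
  shows "ker1 \<noteq> {0}"
  using nonzero_kernel_of_torsion[of UNIV x1] assms nontrivial subspace_UNIV by (auto simp: ker1_def)


subsection \<open>Bases in the two cases\<close>

lemma root_q: "root_of_unity q"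
  unfolding q_def by (intro root_of_unity_mult root_of_unity_inverse root_r root_s)

lemma root_rs: "root_of_unity (r * s)"
  by (intro root_of_unity_mult root_r root_s)

section \<open>The case where X_2 is torsion\<close>

lemma q_power_neq_1: "0 < n \<Longrightarrow> n < mult_ord q \<Longrightarrow> q ^ n \<noteq> 1"
  using mult_ord_dvd_iff[OF root_q, of n] dvd_imp_le[of "mult_ord q" n] by auto

text \<open>The coefficients \<open>d n\<close> and \<open>g n\<close> contain the factor
  \<open>1 - q ^ n\<close>, and the remaining terms of the commutation rules involve
  \<open>x1 v\<close> or \<open>x2 v\<close>.\<close>

lemma pow4_ker12:
  assumes "mult_ord q dvd n" "v \<in> ker12"
  shows "(x4 ^^ n) v \<in> ker12"
proof -
  have "q ^ n = 1" using assms mult_ord_dvd_iff[OF root_q] by simp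
  then have "d n = 0" "g n = 0" by (simp_all add: d_def g_def)
  then show ?thesis using assms(2) x1_pow4[of n v] x2_pow4[of n v]
    by (simp add: ker12_def ker1_def lin_zero[OF lin_funpow[OF lin4]])
qed

text \<open>The length of the basis depends on whether \<xi>2 vanishes, so the starting vector and
  \<xi>2 are chosen together. The vectors \<open>e a\<close> are indexed by all naturals; the cyclic
  end is recorded by the rule for \<open>e (ell4 r s \<xi>2)\<close>.\<close>

lemma xi_basis:
  assumes tors1: "\<And>v. \<exists>n. (x1 ^^ n) v = 0" and tors2: "\<And>v. \<exists>n. (x2 ^^ n) v = 0"
    and tf3: "\<And>v n. v \<noteq> 0 \<Longrightarrow> (x3 ^^ n) v \<noteq> 0"
  obtains \<xi>1 :: complex and e :: "nat \<Rightarrow> 'v" and \<xi>2 :: complex where "\<xi>1 \<noteq> 0"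
    and "\<forall>c. (\<Sum>a<ell4 r s \<xi>2. c a *s e a) = 0 \<longrightarrow> (\<forall>a\<in>{..<ell4 r s \<xi>2}. c a = 0)"
    and "span (e ` {..<ell4 r s \<xi>2}) = UNIV"
    and "\<And>a. x1 (e a) = (g a * \<xi>1) *s e (a - 2)"
    and "\<And>a. x2 (e a) = (d a * \<xi>1) *s e (a - 1)"
    and "\<And>a. x3 (e a) = (inverse (r * s) ^ a * \<xi>1) *s e a"
    and "\<And>a. x4 (e a) = e (Suc a)"
    and "e (ell4 r s \<xi>2) = \<xi>2 *s e 0"
    and "ell4 r s \<xi>2 > 0"
proof -
  let ?p = "mult_ord q" and ?n = "mult_ord (r * s)"
  have ell4: "ell4 r s \<xi>2 = (if \<xi>2 \<noteq> 0 then lcm ?n ?p else ?p)" for \<xi>2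
    by (simp add: ell4_def q_def)
  have p0: "?p > 0" and n0: "?n > 0" using mult_ord_pos root_q root_rs by blast+
  have lin4n: "lin (x4 ^^ n)" for n by (rule lin_funpow[OF lin4])
  have K0: "ker12 \<noteq> {0}"
    unfolding ker12_def by (rule nonzero_kernel_of_torsion[OF ker1_nonzero[OF tors1] subspace_ker1 x2_ker1 tors2])
  \<comment> \<open>This kernel decides the length: a vector of \<open>K\<close> gives \<xi>2 = 0
    and length \<open>?p\<close>, while \<open>K = {0}\<close> forces a nonzero \<xi>2 and the
    longer cycle.\<close>
  define K where "K = {v \<in> ker12. (x4 ^^ ?p) v = 0}"
  have subK: "subspace K" unfolding K_def by (rule subspace_kernel_on[OF lin4n subspace_ker12])
  have "\<exists>w \<xi>1 \<xi>2. w \<in> ker12 \<and> w \<noteq> 0 \<and> x3 w = \<xi>1 *s w \<and> (x4 ^^ ell4 r s \<xi>2) w = \<xi>2 *s w"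
  proof (cases "K = {0}")
    case False
    have "x3 v \<in> K" if "v \<in> K" for v
      using that x3_pow4[of ?p v] r0 s0 by (auto simp: K_def x3_ker12 lins)
    then obtain \<xi>1 w where "w \<in> K" "w \<noteq> 0" "x3 w = \<xi>1 *s w"
      by (rule eigenvector_of_scalar_power[OF lin3 scalar_power_x3 subK _ False])
    then show ?thesis by (intro exI[of _ w] exI[of _ \<xi>1] exI[of _ 0]) (simp add: K_def ell4)
  next
    case True
    obtain \<xi>1 w1 where w1: "w1 \<in> ker12" "w1 \<noteq> 0" "x3 w1 = \<xi>1 *s w1"
      by (rule eigenvector_of_scalar_power[OF lin3 scalar_power_x3 subspace_ker12 x3_ker12 K0])
    let ?E = "{v \<in> ker12. x3 v = \<xi>1 *s v}" and ?l = "lcm ?n ?p"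
    have subE: "subspace ?E" by (rule subspace_eigenspace[OF lin3 subspace_ker12])
    have E0: "?E \<noteq> {0}" using w1 by blast
    \<comment> \<open>As \<open>?l\<close> is a multiple of \<open>?n\<close>, the power
      \<open>x4 ^^ ?l\<close> commutes with \<open>x3\<close>; as it is a multiple of
      \<open>?p\<close>, it preserves \<open>ker12\<close>. So it acts on the eigenspace
      \<open>?E\<close>.\<close>
    have "(r * s) ^ ?l = 1" using mult_ord_dvd_iff[OF root_rs] by auto
    then have inv: "inverse (r * s) ^ ?l = 1" by (simp only: power_inverse inverse_1)
    have "(x4 ^^ ?l) v \<in> ?E" if "v \<in> ?E" for v
      using that x3_pow4[of ?l v] by (simp add: inv pow4_ker12 lin_scale[OF lin4n] del: inverse_mult_distrib)
    then obtain \<xi>2 w where w: "w \<in> ?E" "w \<noteq> 0" "(x4 ^^ ?l) w = \<xi>2 *s w"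
      by (rule eigenvector_of_scalar_power[OF lin4n scalar_power_funpow[OF scalar_power_x4] subE _ E0])
    have inj: "(x4 ^^ ?p) v \<noteq> 0" if "v \<in> ker12" "v \<noteq> 0" for v
      using that True by (auto simp: K_def)
    \<comment> \<open>Since \<open>x4 ^^ ?p\<close> is injective on \<open>ker12\<close> and
      preserves it, its iterates never kill \<open>w\<close>. One of them is
      \<open>x4 ^^ ?l\<close>, whose eigenvalue is therefore nonzero.\<close>
    have *: "(x4 ^^ (j * ?p)) w \<in> ker12 \<and> (x4 ^^ (j * ?p)) w \<noteq> 0" for j
    proof (induction j)
      case (Suc j)
      then show ?case using inj[of "(x4 ^^ (j * ?p)) w"] pow4_ker12[of "Suc j * ?p" w] w
        by (simp add: funpow_add)
    qed (use w in auto)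
    obtain j where "?l = j * ?p" by (metis dvd_lcm2 dvdE mult.commute)
    then have "\<xi>2 \<noteq> 0" using *[of j] w(3) by auto
    then show ?thesis using w by (intro exI[of _ w] exI[of _ \<xi>1] exI[of _ \<xi>2]) (simp add: ell4)
  qed
  then obtain w \<xi>1 \<xi>2 where w: "w \<in> ker12" "w \<noteq> 0" "x3 w = \<xi>1 *s w"
    and wl: "(x4 ^^ ell4 r s \<xi>2) w = \<xi>2 *s w" by blast
  let ?l = "ell4 r s \<xi>2"
  define e where "e a = (x4 ^^ a) w" for a
  have \<xi>1: "\<xi>1 \<noteq> 0" using tf3[OF w(2), of 1] w(3) by auto
  have l0: "?l > 0" using p0 n0 by (auto simp: ell4 intro: lcm_pos_nat)
  have E1: "x1 (e a) = (g a * \<xi>1) *s e (a - 2)" for a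
    using w by (simp add: e_def x1_pow4 ker12_def ker1_def lin_simps[OF lin4n])
  have E2: "x2 (e a) = (d a * \<xi>1) *s e (a - 1)" for a
    using w by (simp add: e_def x2_pow4 ker12_def ker1_def lin_simps[OF lin4n])
  have E3: "x3 (e a) = (inverse (r * s) ^ a * \<xi>1) *s e a" for a
    using w by (simp add: e_def x3_pow4 lin_simps[OF lin4n])
  have E4: "x4 (e a) = e (Suc a)" for a by (simp add: e_def)
  have el: "e ?l = \<xi>2 *s e 0" using wl by (simp add: e_def)
  \<comment> \<open>If \<xi>2 = 0, then \<open>x2\<close> sends \<open>e (Suc a)\<close> to a
    nonzero multiple of \<open>e a\<close> as long as \<open>Suc a < ?p\<close>. Otherwise
    \<open>x4\<close> carries \<open>e a\<close> on to a nonzero multiple of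
    \<open>w\<close>.\<close>
  have e0: "e a \<noteq> 0" if "a < ?l" for a
  proof (cases "\<xi>2 = 0")
    case True
    then have "?l = ?p" by (simp add: ell4)
    with that show ?thesis
    proof (induction a)
      case (Suc a)
      then have "d (Suc a) \<noteq> 0" using q_power_neq_1[of "Suc a"] r0 s0 q1 by (simp add: d_def)
      then have "x2 (e (Suc a)) \<noteq> 0" using Suc \<xi>1 by (simp add: E2)
      then show ?case using lin_zero[OF lin2] by metis
    qed (use w in \<open>simp add: e_def\<close>)
  next
    case False
    show ?thesis
    proof
      assume "e a = 0"
      moreover have "e ?l = (x4 ^^ (?l - a)) (e a)"
        using that by (simp add: e_def flip: funpow_add[THEN fun_cong, unfolded o_apply])
      ultimately show False using el w False by (simp add: lin_zero[OF lin4n] e_def)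
    qed
  qed
  have ind: "c a = 0" if "(\<Sum>a<?l. c a *s e a) = 0" "a < ?l" for c a
  proof (rule separated_eigenvectors_independent[of "{..<?l}" e c a])
    fix i j assume ij: "i \<in> {..<?l}" "j \<in> {..<?l}" "i \<noteq> j"
    show "\<exists>T t. lin T \<and> (\<forall>k\<in>{..<?l}. T (e k) = t k *s e k) \<and> t i \<noteq> t j"
    \<comment> \<open>The eigenvalue of \<open>x3\<close> determines the index modulo
      \<open>?n\<close>. When these agree, that of \<open>x2\<close> after \<open>x4\<close>
      determines it modulo \<open>?p\<close>, hence modulo \<open>?l\<close>.\<close>
    proof (cases "(r * s) ^ i = (r * s) ^ j")
      case False
      then have "inverse (r * s) ^ i * \<xi>1 \<noteq> inverse (r * s) ^ j * \<xi>1"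
        using \<xi>1 by (simp only: power_inverse) simp
      then show ?thesis using lin3 E3
        by (intro exI[of _ x3] exI[of _ "\<lambda>a. inverse (r * s) ^ a * \<xi>1"]) blast
    next
      case True
      then have n: "i mod ?n = j mod ?n" using power_eq_iff_cong_mult_ord[OF root_rs] by simp
      have "q ^ i \<noteq> q ^ j"
      proof
        assume "q ^ i = q ^ j"
        then have p: "i mod ?p = j mod ?p" using power_eq_iff_cong_mult_ord[OF root_q] by simp
        have "i mod ?l = j mod ?l"
          unfolding ell4 by (simp only: p mod_lcm_eq[OF n p] split: if_split) blast
        then show False using ij by simp
      qed
      then have "d (Suc i) * \<xi>1 \<noteq> d (Suc j) * \<xi>1"
        using True \<xi>1 q0 q1 r0 s0 by (simp add: d_def power_int_minus)
      moreover have "x2 (x4 (e a)) = (d (Suc a) * \<xi>1) *s e a" for a by (simp add: E4 E2)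
      ultimately show ?thesis using lin_comp[OF lin2 lin4]
        by (intro exI[of _ "\<lambda>v. x2 (x4 v)"] exI[of _ "\<lambda>a. d (Suc a) * \<xi>1"]) blast
    qed
  qed (use that e0 in auto)
  have in_span: "c *s e a \<in> span (e ` {..<?l})" if "a < ?l" for a c
    using that by (intro span_scale span_base) auto
  have "span (e ` {..<?l}) = UNIV"
  proof (rule span_eq_UNIV)
    show "e 0 \<in> e ` {..<?l}" "e 0 \<noteq> 0" using l0 e0 by auto
    fix v assume "v \<in> e ` {..<?l}"
    then obtain a where a: "v = e a" "a < ?l" by auto
    show "x1 v \<in> span (e ` {..<?l})" using a by (simp add: E1 in_span)
    show "x4 v \<in> span (e ` {..<?l})"
    proof (cases "Suc a = ?l")
      case True
      then show ?thesis using a el l0 in_span[of 0 \<xi>2] by (simp add: E4)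
    next
      case False
      then show ?thesis using a in_span[of "Suc a" 1] by (simp add: E4)
    qed
  qed
  moreover have "\<forall>c. (\<Sum>a<?l. c a *s e a) = 0 \<longrightarrow> (\<forall>a\<in>{..<?l}. c a = 0)"
    using ind by blast
  ultimately show ?thesis using that \<xi>1 E1 E2 E3 E4 el l0 by blast
qed

section \<open>The case where X_2 is torsionfree\<close>

abbreviation Q where "Q \<equiv> (inverse r * s)^2"

abbreviation l3 where "l3 \<equiv> mult_ord (r * s)"

abbreviation mQ where "mQ \<equiv> mult_ord Q"

lemma root_Q: "root_of_unity Q"
  by (intro root_of_unity_power root_of_unity_mult root_of_unity_inverse root_r root_s)

text \<open>The power of \<open>s^2\<close> is the factor between the two orders of Z^mQ and X_2^l3.
  The case distinction thus asks whether these powers commute.\<close>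

lemma m3_eq: "m3 r s \<nu> = (if (s^2) ^ (mQ * l3) = 1 \<or> \<nu> = 0 then mQ else 2 * mQ)"
proof -
  have "r powi (-2) * s^2 = Q" by (simp add: power_int_minus power_mult_distrib power_inverse)
  then show ?thesis
    unfolding m3_def using mult_ord_dvd_iff[OF root_of_unity_power[OF root_s, of 2]] by simp
qed

lemma rs_l3: "(r * s) ^ l3 = 1"
  by (rule power_mult_ord[OF root_rs])

text \<open>From \<open>s^2 * s^2 = Q * (r * s)^2\<close> the square of this number is 1. Hence Z^mQ
  and X_2^l3 commute or anticommute, and doubling \<open>mQ\<close> always suffices.\<close>

lemma s2_sign: "(s^2) ^ (mQ * l3) = 1 \<or> (s^2) ^ (mQ * l3) = -1"
proof -
  have "s^2 * s^2 = Q * (r * s)^2" using r0 by (simp add: power_mult_distrib field_simps)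
  then have "((s^2) ^ (mQ * l3))^2 = Q ^ (mQ * l3) * ((r * s)^2) ^ (mQ * l3)"
    by (simp only: power2_eq_square flip: power_mult_distrib)
  also have "Q ^ (mQ * l3) = 1"
    by (simp only: power_mult power_mult_ord[OF root_Q] power_one)
  also have "((r * s)^2) ^ (mQ * l3) = 1"
    by (metis power_mult mult.commute rs_l3 power_one)
  finally show ?thesis by (simp add: power2_eq_1_iff)
qed

lemma C_eq_0_iff: "C n = 0 \<longleftrightarrow> mQ dvd n"
proof -
  have "Q \<noteq> 1" using r2_s2 r0 by (simp add: power_mult_distrib power_inverse field_simps)
  then show ?thesis using s0 mult_ord_dvd_iff[OF root_Q, of n] by (auto simp: C_def power_mult)
qed

text \<open>The defect in \<open>x1_powz\<close> carries the factor \<open>C n\<close>, which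
  vanishes at the multiples of \<open>mQ\<close>.\<close>

lemma powz_ker1: "mQ dvd n \<Longrightarrow> v \<in> ker1 \<Longrightarrow> (z ^^ n) v \<in> ker1"
  using x1_powz[of n v] C_eq_0_iff[of n] by (simp add: ker1_def lin_zero[OF lin_funpow[OF linz]])

lemma pow2_ker1: "v \<in> ker1 \<Longrightarrow> (x2 ^^ n) v \<in> ker1"
  by (rule funpow_mem[OF x2_ker1])

lemma pow2_powz: "(x2 ^^ a) ((z ^^ b) v) = inverse (s^2) ^ (a * b) *s (z ^^ b) ((x2 ^^ a) v)"
  by (rule qcomm_funpow_funpow[OF linz lin2 x2_z])

lemma powz_pow2: "(z ^^ b) ((x2 ^^ a) v) = (s^2) ^ (a * b) *s (x2 ^^ a) ((z ^^ b) v)"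
  using s0 by (simp add: pow2_powz power_inverse)

text \<open>Eigenspaces are cut down one operator at a time. The power of \<open>x2\<close> commutes
  with \<open>x3\<close> because \<open>(r * s) ^ l3 = 1\<close>. Commutation with
  \<open>z ^^ M\<close> is asked only on \<open>K\<close>, so that a kernel on which both products
  vanish qualifies.\<close>

lemma nu_joint_eigenvector:
  assumes K: "subspace K" "K \<noteq> {0}" "\<And>v. v \<in> K \<Longrightarrow> x3 v \<in> K"
    "\<And>v. v \<in> K \<Longrightarrow> (x2 ^^ l3) v \<in> K" "\<And>v. v \<in> K \<Longrightarrow> (z ^^ M) v \<in> K"
    and comm: "\<And>v. v \<in> K \<Longrightarrow> (x2 ^^ l3) ((z ^^ M) v) = (z ^^ M) ((x2 ^^ l3) v)"
  obtains w \<nu>2 \<mu> \<nu>3 where "w \<in> K" "w \<noteq> 0" "x3 w = \<nu>2 *s w" "(x2 ^^ l3) w = \<mu> *s w" "(z ^^ M) w = \<nu>3 *s w"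
proof -
  have l2: "lin (x2 ^^ l3)" and lz: "lin (z ^^ M)" by (intro lin_funpow lin2 linz)+
  obtain \<nu>2 w1 where w1: "w1 \<in> K" "w1 \<noteq> 0" "x3 w1 = \<nu>2 *s w1"
    by (rule eigenvector_of_scalar_power[OF lin3 scalar_power_x3 K(1,3,2)])
  let ?E = "{v \<in> K. x3 v = \<nu>2 *s v}"
  have E: "subspace ?E" by (rule subspace_eigenspace[OF lin3 K(1)])
  have E2: "(x2 ^^ l3) v \<in> ?E" if "v \<in> ?E" for v
    using that K(4) qcomm_funpow[OF lin2 lin3 R23, of l3 v] by (simp add: rs_l3 lin_scale[OF l2])
  have E0: "?E \<noteq> {0}" using w1 by blast
  obtain \<mu> w2 where w2: "w2 \<in> ?E" "w2 \<noteq> 0" "(x2 ^^ l3) w2 = \<mu> *s w2"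
    by (rule eigenvector_of_scalar_power[OF l2 scalar_power_funpow[OF scalar_power_x2] E E2 E0])
  let ?F = "{v \<in> ?E. (x2 ^^ l3) v = \<mu> *s v}"
  have F: "subspace ?F" by (rule subspace_eigenspace[OF l2 E])
  have Fz: "(z ^^ M) v \<in> ?F" if "v \<in> ?F" for v
    using that K(5) comm[of v] qcomm_funpow[OF linz lin3, of 1 M v]
    by (simp add: x3_z lin_scale[OF lz])
  have F0: "?F \<noteq> {0}" using w2 by blast
  obtain \<nu>3 w where "w \<in> ?F" "w \<noteq> 0" "(z ^^ M) w = \<nu>3 *s w"
    by (rule eigenvector_of_scalar_power[OF lz scalar_power_funpow[OF scalar_power_z] F Fz F0])
  then show ?thesis using that by blast
qed

text \<open>If Z^mQ commutes with X_2^l3, it is used directly. If they anticommute, either Z^mQ has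
  a kernel in \<open>ker1\<close> and \<nu>3 = 0 works there, or it is injective and Z^(2 mQ) is
  used. The last conclusion makes the top rule compatible with reading the first index modulo
  \<open>l3\<close>.\<close>

lemma nu_highest_weight_vector:
  assumes tors1: "\<And>v. \<exists>n. (x1 ^^ n) v = 0"
  obtains w \<nu>2 \<mu> \<nu>3 where "w \<in> ker1" "w \<noteq> 0" "x3 w = \<nu>2 *s w" "(x2 ^^ l3) w = \<mu> *s w"
    and "(z ^^ m3 r s \<nu>3) w = \<nu>3 *s w" "(s^2) ^ (l3 * m3 r s \<nu>3) * \<nu>3 = \<nu>3"
proof -
  note K0 = ker1_nonzero[OF tors1]
  have comm: "(x2 ^^ l3) ((z ^^ M) v) = (z ^^ M) ((x2 ^^ l3) v)" if "(s^2) ^ (l3 * M) = 1" for M v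
    using that by (simp add: powz_pow2)
  consider "(s^2) ^ (mQ * l3) = 1" | "(s^2) ^ (mQ * l3) = -1" "{v \<in> ker1. (z ^^ mQ) v = 0} \<noteq> {0}"
    | "(s^2) ^ (mQ * l3) = -1" "{v \<in> ker1. (z ^^ mQ) v = 0} = {0}"
    using s2_sign by blast
  then show ?thesis
  proof cases
    case 1
    then have s1: "(s^2) ^ (l3 * mQ) = 1" by (simp add: mult.commute)
    obtain w \<nu>2 \<mu> \<nu>3 where w: "w \<in> ker1" "w \<noteq> 0" "x3 w = \<nu>2 *s w" "(x2 ^^ l3) w = \<mu> *s w" "(z ^^ mQ) w = \<nu>3 *s w"
      by (rule nu_joint_eigenvector[OF subspace_ker1 K0 x3_ker1 pow2_ker1 powz_ker1[OF dvd_refl] comm[OF s1]])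
    then show ?thesis by (intro that[OF w(1-4), of \<nu>3]) (use 1 in \<open>simp_all add: m3_eq mult.commute\<close>)
  next
    case 2
    let ?K = "{v \<in> ker1. (z ^^ mQ) v = 0}"
    have lz: "lin (z ^^ mQ)" by (rule lin_funpow[OF linz])
    have x3K: "x3 v \<in> ?K" if "v \<in> ?K" for v
      using that qcomm_funpow[OF linz lin3, of 1 mQ v] by (auto simp: x3_z x3_ker1 lins)
    have x2K: "(x2 ^^ l3) v \<in> ?K" if "v \<in> ?K" for v
      using that by (simp add: powz_pow2 pow2_ker1 lin_zero[OF lin_funpow[OF lin2]])
    have subK: "subspace ?K" by (rule subspace_kernel_on[OF lz subspace_ker1])
    have zK: "(z ^^ mQ) v \<in> ?K" if "v \<in> ?K" for v
      using that subspace_0[OF subspace_ker1] by (simp add: lin_zero[OF lz])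
    have commK: "(x2 ^^ l3) ((z ^^ mQ) v) = (z ^^ mQ) ((x2 ^^ l3) v)" if "v \<in> ?K" for v
      using that x2K[OF that] by (simp add: lin_zero[OF lin_funpow[OF lin2]])
    obtain w \<nu>2 \<mu> \<nu>3 where w: "w \<in> ?K" "w \<noteq> 0" "x3 w = \<nu>2 *s w" "(x2 ^^ l3) w = \<mu> *s w"
      by (rule nu_joint_eigenvector[OF subK 2(2) x3K x2K zK commK])
    \<comment> \<open>The value 0 is inserted for \<nu>3, since \<open>z ^^ mQ\<close> kills
      \<open>w\<close> and \<open>m3 r s 0\<close> is \<open>mQ\<close>.\<close>
    then show ?thesis by (intro that[of w \<nu>2 \<mu> 0]) (simp_all add: m3_eq)
  next
    case 3
    have inj: "(z ^^ mQ) v \<noteq> 0" if "v \<in> ker1" "v \<noteq> 0" for v using 3(2) that by auto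
    have "(s^2) ^ (l3 * (2 * mQ)) = ((s^2) ^ (mQ * l3))^2"
      by (simp only: mult_ac flip: power_mult)
    also have "\<dots> = 1" using 3(1) by simp
    finally have s1: "(s^2) ^ (l3 * (2 * mQ)) = 1" .
    obtain w \<nu>2 \<mu> \<nu>3 where w: "w \<in> ker1" "w \<noteq> 0" "x3 w = \<nu>2 *s w" "(x2 ^^ l3) w = \<mu> *s w"
      and \<nu>3: "(z ^^ (2 * mQ)) w = \<nu>3 *s w"
      by (rule nu_joint_eigenvector[OF subspace_ker1 K0 x3_ker1 pow2_ker1 powz_ker1[OF dvd_triv_right] comm[OF s1]])
    have "(z ^^ (2 * mQ)) w = (z ^^ mQ) ((z ^^ mQ) w)"
      unfolding mult_2 by (simp add: funpow_add)
    \<comment> \<open>Injectivity applies twice because \<open>(z ^^ mQ) w\<close> is again in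
      \<open>ker1\<close>; a nonzero \<nu>3 is what selects the doubled length.\<close>
    then have "\<nu>3 \<noteq> 0" using inj[of w] inj[of "(z ^^ mQ) w"] w(1,2) powz_ker1[OF dvd_refl, of w] \<nu>3 by auto
    then have "m3 r s \<nu>3 = 2 * mQ" using 3(1) by (simp add: m3_eq)
    then show ?thesis using that[OF w, of \<nu>3] \<nu>3 s1 by simp
  qed
qed

text \<open>Both indices run over all naturals, so that the action needs no case distinction; the
  wrap-around is kept in separate rules for the two indices.\<close>

lemma nu_basis:
  assumes tors1: "\<And>v. \<exists>n. (x1 ^^ n) v = 0"
    and tf2: "\<And>v n. v \<noteq> 0 \<Longrightarrow> (x2 ^^ n) v \<noteq> 0"
    and tf3: "\<And>v n. v \<noteq> 0 \<Longrightarrow> (x3 ^^ n) v \<noteq> 0"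
  obtains \<nu>1 \<nu>2 :: complex and e :: "nat \<times> nat \<Rightarrow> 'v" and \<nu>3 :: complex where "\<nu>1 \<noteq> 0" "\<nu>2 \<noteq> 0"
    and "\<forall>c. (\<Sum>p\<in>index_nu r s \<nu>3. c p *s e p) = 0 \<longrightarrow> (\<forall>p\<in>index_nu r s \<nu>3. c p = 0)"
    and "span (e ` index_nu r s \<nu>3) = UNIV"
    and "\<And>a b. x1 (e (a, b)) = (- (inverse (r^2) * k * C b) * \<nu>1^2) *s e (a + 2, b - 1)"
    and "\<And>a b. x2 (e (a, b)) = (inverse (s^2) ^ b * \<nu>1) *s e (Suc a, b)"
    and "\<And>a b. x3 (e (a, b)) = ((r * s) ^ a * \<nu>2) *s e (a, b)"
    and "\<And>a b. x4 (e (Suc a, b)) = ((s^2) ^ b / k) *s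
      (inverse \<nu>1 *s e (a, Suc b) - ((r * s) ^ a * inverse \<nu>1 * \<nu>2) *s e (a, b))"
    and "\<And>a b. e (a, b) = e (a mod ell3 r s, b)"
    and "\<And>a. e (a, m3 r s \<nu>3) = ((s^2) ^ (a * m3 r s \<nu>3) * \<nu>3) *s e (a, 0)"
    and "(s^2) ^ (ell3 r s * m3 r s \<nu>3) * \<nu>3 = \<nu>3"
proof -
  obtain w \<nu>2 \<mu> \<nu>3 where w: "w \<in> ker1" "w \<noteq> 0" "x3 w = \<nu>2 *s w" and w\<mu>: "(x2 ^^ l3) w = \<mu> *s w"
    and wM: "(z ^^ m3 r s \<nu>3) w = \<nu>3 *s w" and sM: "(s^2) ^ (l3 * m3 r s \<nu>3) * \<nu>3 = \<nu>3"
    by (rule nu_highest_weight_vector[OF tors1])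
  let ?l = l3 and ?M = "m3 r s \<nu>3"
  have ell3: "ell3 r s = ?l" by (simp add: ell3_def)
  have l0: "?l > 0" by (rule mult_ord_pos[OF root_rs])
  have mQ0: "mQ > 0" by (rule mult_ord_pos[OF root_Q])
  have M0: "?M > 0" using mQ0 by (simp add: m3_eq)
  have \<nu>2: "\<nu>2 \<noteq> 0" using tf3[OF w(2), of 1] w(3) by auto
  have "\<mu> \<noteq> 0" using tf2[OF w(2), of l3] w\<mu> by auto
  \<comment> \<open>With an \<open>l3\<close>-th root of the eigenvalue of X_2^l3 as normalizing
    factor, the vectors become periodic in the first index.\<close>
  obtain \<nu>1 where "\<nu>1 ^ l3 = \<mu>" using nth_root_exists[OF l0] by blast
  then have \<nu>1: "\<nu>1 \<noteq> 0" and w\<nu>1: "(x2 ^^ l3) w = \<nu>1 ^ l3 *s w"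
    using \<open>\<mu> \<noteq> 0\<close> l0 w\<mu> by (auto simp: zero_power)
  have linzn: "lin (z ^^ n)" and lin2n: "lin (x2 ^^ n)" for n by (intro lin_funpow linz lin2)+
  define e where "e = (\<lambda>(a, b). inverse \<nu>1 ^ a *s (z ^^ b) ((x2 ^^ a) w))"
  have e: "e (a, b) = inverse \<nu>1 ^ a *s (z ^^ b) ((x2 ^^ a) w)" for a b by (simp add: e_def)
  have E1: "x1 (e (a, b)) = (- (inverse (r^2) * k * C b) * \<nu>1^2) *s e (a + 2, b - 1)" for a b
  proof -
    have "x1 ((x2 ^^ a) w) = 0" using pow2_ker1[OF w(1)] by (simp add: ker1_def)
    then have "x1 (e (a, b)) = inverse \<nu>1 ^ a *s (- (inverse (r^2) * k * C b)) *s (z ^^ (b - 1)) ((x2 ^^ (a + 2)) w)"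
      by (simp add: e x1_powz lin_simps[OF lin1] lin_zero[OF linzn])
    moreover have "inverse \<nu>1 ^ a = \<nu>1^2 * inverse \<nu>1 ^ (a + 2)"
      using \<nu>1 by (simp add: power_add power2_eq_square) (simp add: field_simps)
    ultimately show ?thesis by (simp add: e mult_ac del: power_Suc)
  qed
  have E2: "x2 (e (a, b)) = (inverse (s^2) ^ b * \<nu>1) *s e (Suc a, b)" for a b
    using \<nu>1 pow2_powz[of 1 b "(x2 ^^ a) w"] by (simp add: e lin_simps[OF lin2] mult_ac)
  have E3: "x3 (e (a, b)) = ((r * s) ^ a * \<nu>2) *s e (a, b)" for a b
    using qcomm_funpow[OF linz lin3, of 1 b "(x2 ^^ a) w"] qcomm_funpow[OF lin2 lin3 R23, of a w]
    by (simp add: e x3_z w(3) lin_simps[OF lin3] lin_simps[OF linzn] lin_simps[OF lin2n] mult_ac)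
  have Ez: "z (e (a, b)) = e (a, Suc b)" for a b
    by (simp add: e lin_simps[OF linz])
  have E4: "x4 (e (Suc a, b)) = ((s^2) ^ b / k) *s
      (inverse \<nu>1 *s e (a, Suc b) - ((r * s) ^ a * inverse \<nu>1 * \<nu>2) *s e (a, b))" for a b
  proof -
    \<comment> \<open>The definition of \<open>z\<close> gives \<open>x4\<close> only on the image
      of \<open>x2\<close>, hence the successor in the first index.\<close>
    have "e (Suc a, b) = ((s^2) ^ b * inverse \<nu>1) *s x2 (e (a, b))"
      using \<nu>1 s0 by (simp add: E2 power_inverse field_simps)
    then have "x4 (e (Suc a, b)) = ((s^2) ^ b * inverse \<nu>1) *s inverse k *s (e (a, Suc b) - ((r * s) ^ a * \<nu>2) *s e (a, b))"
      by (simp only: lin_simps[OF lin4] x4_x2 Ez E3)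
    then show ?thesis by (simp add: scale_right_diff_distrib divide_inverse mult_ac)
  qed
  have per: "e (a + ?l, b) = e (a, b)" for a b
    using \<nu>1 by (simp add: e funpow_add w\<nu>1 lin_simps[OF linzn] lin_simps[OF lin2n] power_add power_inverse)
  have "e (a + j * ?l, b) = e (a, b)" for a b j
  proof (induction j)
    case (Suc j)
    have "a + Suc j * ?l = (a + j * ?l) + ?l" by simp
    then show ?case using Suc per by metis
  qed simp
  then have mod: "e (a, b) = e (a mod ?l, b)" for a b
    by (metis mod_mult_div_eq mult.commute)
  have top: "e (a, ?M) = ((s^2) ^ (a * ?M) * \<nu>3) *s e (a, 0)" for a
    by (simp add: e powz_pow2 wM lin_simps[OF lin2n] mult_ac)
  have e00: "e (a, 0) \<noteq> 0" for a using tf2[OF w(2)] \<nu>1 by (simp add: e)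
  \<comment> \<open>If \<nu>3 = 0, \<open>x1\<close> lowers \<open>b\<close> with a nonzero factor
    below \<open>mQ\<close>. Otherwise \<open>z\<close> raises the vector to a nonzero multiple of
    \<open>e (a, 0)\<close>.\<close>
  have enz: "e (a, b) \<noteq> 0" if "b < ?M" for a b
  proof (cases "\<nu>3 = 0")
    case True
    then have "?M = mQ" by (simp add: m3_eq)
    with that show ?thesis
    proof (induction b arbitrary: a)
      case (Suc b)
      have "C (Suc b) \<noteq> 0"
        using Suc.prems dvd_imp_le[of mQ "Suc b"] by (auto simp: C_eq_0_iff)
      then have "x1 (e (a, Suc b)) \<noteq> 0" using Suc k0 r0 \<nu>1 by (simp add: E1)
      then show ?case using lin_zero[OF lin1] by metis
    qed (use e00 in simp)
  next
    case False
    have "(z ^^ n) (e (a, b)) = e (a, b + n)" for n by (induction n) (simp_all add: Ez)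
    then have "(z ^^ (?M - b)) (e (a, b)) = e (a, ?M)" using that by simp
    moreover have "e (a, ?M) \<noteq> 0" using top[of a] e00 False s0 by simp
    ultimately show ?thesis using lin_zero[OF linzn] by metis
  qed
  have x2n: "(x2 ^^ n) (e (a, b)) = (inverse (s^2) ^ b * \<nu>1) ^ n *s e (a + n, b)" for n a b
    by (induction n) (simp_all add: lin_simps[OF lin2] E2 mult_ac)
  \<comment> \<open>The eigenvalue of Z X_1 X_2^(2l-2): Z and X_1 restore \<open>b\<close> and shift
    \<open>a\<close> by 2, and the power of X_2 completes the shift to 2l, which is 0 modulo
    l.\<close>
  define t where "t b = - (inverse (r^2) * k * C (Suc b)) * \<nu>1^2 * (inverse (s^2) ^ b * \<nu>1) ^ (2 * ?l - 2)" for b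
  have D: "(x2 ^^ (2 * ?l - 2)) (x1 (z (e (a, b)))) = t b *s e (a, b)" for a b
  proof -
    have l: "a + 2 + (2 * ?l - 2) = a + 2 * ?l" using l0 by simp
    have "e (a + 2 + (2 * ?l - 2), b) = e (a, b)"
      unfolding l using mod[of "a + 2 * ?l" b] mod[of a b] by simp
    then show ?thesis
      by (simp only: Ez E1[of a "Suc b"] lin_simps[OF lin2n] x2n t_def scale_scale diff_Suc_1)
  qed
  \<comment> \<open>In this form \<open>t b\<close> depends on \<open>b\<close> only through
    \<open>u ^ b\<close> and \<open>Q ^ b\<close>, with \<open>u\<close> as defined below.\<close>
  have t_eq: "t b = - (inverse (r^2) * k * \<nu>1^2 * \<nu>1 ^ (2 * ?l - 2) / (1 - Q))
      * ((inverse (s^2) ^ ?l) ^ b)^2 * (1 - Q ^ Suc b)" for b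
  proof -
    have "s powi (-4 * int b) = (s powi (-4)) powi int b" by (rule power_int_mult)
    also have "s powi (-4) = inverse (s^2) ^ 2" using s0 by (simp add: power_int_minus power_inverse)
    also have "(inverse (s^2) ^ 2) powi int b = inverse (s^2) ^ (2 * b)"
      by (simp add: power_mult)
    finally have s: "s powi (-4 * int b) = inverse (s^2) ^ (2 * b)" .
    have C: "C (Suc b) = inverse (s^2) ^ (2 * b) * ((1 - Q ^ Suc b) / (1 - Q))"
      using s unfolding C_def power_mult[of _ 2 "Suc b"] by simp
    have "2 * b + b * (2 * ?l - 2) = ?l * b * 2" using l0 by (simp add: algebra_simps)
    then have "inverse (s^2) ^ (2 * b) * (inverse (s^2) ^ b) ^ (2 * ?l - 2) = ((inverse (s^2) ^ ?l) ^ b)^2"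
      by (simp only: power_mult[symmetric] power_add[symmetric])
    then show ?thesis unfolding t_def C power_mult_distrib[of _ \<nu>1]
      by (simp add: mult_ac del: power_Suc)
  qed
  have Q1: "Q \<noteq> 1" using r2_s2 r0 by (simp add: power_mult_distrib power_inverse field_simps)
  define u where "u = inverse (s^2) ^ ?l"
  have ind: "c p = 0" if "(\<Sum>p\<in>index_nu r s \<nu>3. c p *s e p) = 0" "p \<in> index_nu r s \<nu>3" for c p
  proof (rule separated_eigenvectors_independent[of "index_nu r s \<nu>3" e c p])
    fix i j assume ij: "i \<in> index_nu r s \<nu>3" "j \<in> index_nu r s \<nu>3" "i \<noteq> j"
    obtain a b a' b' where i: "i = (a, b)" and j: "j = (a', b')" by fastforce
    have ab: "a < ?l" "b < ?M" "a' < ?l" "b' < ?M" using ij by (auto simp: i j index_nu_def ell3)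
    \<comment> \<open>The operator \<open>x3\<close> separates the first index. For equal first
      index, \<open>x2 ^^ ?l\<close> separates different \<open>u ^ b\<close>, and for equal
      \<open>u ^ b\<close> the eigenvalues \<open>t b\<close> separate different
      \<open>Q ^ b\<close>.\<close>
    show "\<exists>T t. lin T \<and> (\<forall>p\<in>index_nu r s \<nu>3. T (e p) = t p *s e p) \<and> t i \<noteq> t j"
    proof (cases "a = a'")
      case False
      then have "(r * s) ^ a \<noteq> (r * s) ^ a'"
        using ab power_eq_iff_cong_mult_ord[OF root_rs] by simp
      then show ?thesis using lin3 E3 \<nu>2
        by (intro exI[of _ x3] exI[of _ "\<lambda>(a, b). (r * s) ^ a * \<nu>2"]) (auto simp: i j)
    next
      case True
      then have bb: "b \<noteq> b'" using ij by (simp add: i j)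
      show ?thesis
      proof (cases "u ^ b = u ^ b'")
        case False
        have "(x2 ^^ ?l) (e p) = (case p of (a, b) \<Rightarrow> u ^ b * \<nu>1 ^ ?l) *s e p" for p
          by (cases p) (simp add: x2n per power_mult_distrib u_def flip: power_mult, simp add: mult.commute)
        then show ?thesis using lin2n False \<nu>1
          by (intro exI[of _ "x2 ^^ ?l"] exI[of _ "\<lambda>(a, b). u ^ b * \<nu>1 ^ ?l"]) (auto simp: i j)
      next
        case u: True
        \<comment> \<open>Otherwise \<open>b\<close> and \<open>b'\<close> agree modulo
          \<open>mQ\<close>, which requires the doubled range and the sign -1. They then differ by
          \<open>mQ\<close>, and \<open>u ^ mQ = -1\<close> contradicts
          \<open>u ^ b = u ^ b'\<close>.\<close>
        have "Q ^ b \<noteq> Q ^ b'"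
        proof
          assume "Q ^ b = Q ^ b'"
          then have mod: "b mod mQ = b' mod mQ" using power_eq_iff_cong_mult_ord[OF root_Q] by simp
          have "?M \<noteq> mQ" using mod bb ab by auto
          then have M: "?M = 2 * mQ" and s: "(s^2) ^ (mQ * l3) = -1"
            using s2_sign by (auto simp: m3_eq split: if_splits)
          have "u ^ mQ = inverse ((s^2) ^ (mQ * l3))"
            unfolding u_def power_inverse by (simp add: mult_ac flip: power_mult)
          then have um: "u ^ mQ = -1" using s by simp
          have u0: "u \<noteq> 0" using s0 by (simp add: u_def)
          have "b' = b + mQ \<or> b = b' + mQ"
          proof -
            have "b div mQ < 2" "b' div mQ < 2" using ab M by (simp_all add: less_mult_imp_div_less)
            moreover have "b div mQ \<noteq> b' div mQ" using bb mod by (metis div_mult_mod_eq)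
            ultimately consider "b div mQ = 0" "b' div mQ = 1" | "b div mQ = 1" "b' div mQ = 0"
              by linarith
            then show ?thesis
              using mod div_mult_mod_eq[of b mQ] div_mult_mod_eq[of b' mQ] by cases simp_all
          qed
          then show False using u um u0 by (auto simp: power_add)
        qed
        moreover have "t b = t b' \<Longrightarrow> Q ^ Suc b = Q ^ Suc b'"
        proof -
          let ?c = "- (inverse (r^2) * k * \<nu>1^2 * \<nu>1 ^ (2 * ?l - 2) / (1 - Q)) * (u ^ b')^2"
          have "?c \<noteq> 0" using r0 k0 \<nu>1 Q1 s0 by (simp add: u_def)
          moreover assume "t b = t b'"
          then have "?c * (1 - Q ^ Suc b) = ?c * (1 - Q ^ Suc b')"
            using u by (simp only: t_eq flip: u_def)
          ultimately have "1 - Q ^ Suc b = 1 - Q ^ Suc b'" by (rule mult_left_cancel[THEN iffD1])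
          then show ?thesis by simp
        qed
        ultimately have "t b \<noteq> t b'" using r0 s0 by auto
        moreover have "lin (\<lambda>v. (x2 ^^ (2 * ?l - 2)) (x1 (z v)))"
          by (rule lin_comp[OF lin2n lin_comp[OF lin1 linz]])
        ultimately show ?thesis using D
          by (intro exI[of _ "\<lambda>v. (x2 ^^ (2 * ?l - 2)) (x1 (z v))"] exI[of _ "\<lambda>(a, b). t b"]) (auto simp: i j)
      qed
    qed
  qed (use that enz in \<open>auto simp: index_nu_def\<close>)
  let ?S = "e ` index_nu r s \<nu>3"
  have in_span: "c *s e (a, b) \<in> span ?S" if "b < ?M" for a b c
  proof -
    have "e (a, b) \<in> ?S" using mod[of a b] that l0 by (auto simp: index_nu_def ell3)
    then show ?thesis by (intro span_scale span_base)
  qed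
  have span: "span ?S = UNIV"
  proof (rule span_eq_UNIV)
    show "e (0, 0) \<in> ?S" "e (0, 0) \<noteq> 0" using l0 M0 e00 by (auto simp: index_nu_def ell3)
    fix v assume "v \<in> ?S"
    then obtain a b where v: "v = e (a, b)" "b < ?M" by (auto simp: index_nu_def)
    show "x1 v \<in> span ?S" unfolding v(1) E1 by (rule in_span) (use v in simp)
    have "c *s e (a', Suc b) \<in> span ?S" for a' c
    proof (cases "Suc b = ?M")
      case True
      then show ?thesis using in_span[OF M0, of "c * ((s^2) ^ (a' * ?M) * \<nu>3)" a'] by (simp only: top scale_scale)
    next
      case False
      then show ?thesis using v by (intro in_span) simp
    qed
    \<comment> \<open>Adding one period turns the first index into a successor, as \<open>E4\<close>
      demands.\<close>
    moreover have "v = e (Suc (a + (?l - 1)), b)" using per[of a b] l0 v by simp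
    ultimately show "x4 v \<in> span ?S"
      using v(2) by (simp only: E4 in_span span_scale span_diff)
  qed
  have ind': "\<forall>c. (\<Sum>p\<in>index_nu r s \<nu>3. c p *s e p) = 0 \<longrightarrow> (\<forall>p\<in>index_nu r s \<nu>3. c p = 0)"
    using ind by blast
  show ?thesis
    by (rule that[of \<nu>1 \<nu>2 e \<nu>3, unfolded ell3])
      (fact \<nu>1 \<nu>2 ind' span E1 E2 E3 E4 mod top sM)+
qed

end


section \<open>Modules over the presented algebra\<close>

lemma free_alg_induct [case_names single add]:
  fixes p :: free_alg
  assumes single: "\<And>k c. P (Poly_Mapping.single k c)" and add: "\<And>p q. P p \<Longrightarrow> P q \<Longrightarrow> P (p + q)"
  shows "P p"
proof (induction p rule: update_induct)
  case const
  then show ?case using single[of 0 0] by simp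
next
  case (update f a b)
  have "Poly_Mapping.update a b f = f + Poly_Mapping.single a b"
    using update(1) by (intro poly_mapping_eqI)
      (auto simp: lookup_update lookup_add lookup_single when_def in_keys_iff)
  then show ?case using add[OF update(3) single] by simp
qed

lemma fscal_add: "fscal (a + b) = fscal a + fscal b"
  and fscal_mult: "fscal (a * b) = fscal a * fscal b"
  and fscal_1: "fscal 1 = 1"
  by (simp_all add: fscal_def single_add mult_single)

lemma fscal_commute: "fscal c * p = p * fscal c"
  by (induction p rule: free_alg_induct)
    (simp_all add: fscal_def mult_single mult.commute distrib_left distrib_right)

lemma single_eq_fscal_mult: "Poly_Mapping.single k c = fscal c * Poly_Mapping.single k 1"
  by (simp add: fscal_def mult_single)

lemma single_Word_Cons:
  "Poly_Mapping.single (Word (g # gs)) 1 = Poly_Mapping.single (Word [g]) 1 * (Poly_Mapping.single (Word gs) 1 :: free_alg)"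
  by (simp add: mult_single plus_word_def)

lemma free_ring_sel [simp]:
  "carrier free_ring = UNIV" "monoid.mult free_ring = (*)" "monoid.one free_ring = 1"
  "ring.add free_ring = (+)" "ring.zero free_ring = 0"
  by (simp_all add: free_ring_def ring_of_type_algebra_def)

lemma cls_hom: "cls r s \<in> ring_hom free_ring (UB2 r s)"
  using ideal.rcos_ring_hom[OF ideal_rel_ideal] unfolding UB2_def cls_def by simp

lemma cls_carrier: "cls r s p \<in> carrier (UB2 r s)"
  using ring_hom_closed[OF cls_hom] by simp

lemma cls_add: "cls r s (p + q) = cls r s p \<oplus>\<^bsub>UB2 r s\<^esub> cls r s q"
  using ring_hom_add[OF cls_hom, of p q] by simp

lemma cls_mult: "cls r s (p * q) = cls r s p \<otimes>\<^bsub>UB2 r s\<^esub> cls r s q"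
  using ring_hom_mult[OF cls_hom, of p q] by simp

lemma cls_one: "cls r s 1 = \<one>\<^bsub>UB2 r s\<^esub>"
  using ring_hom_one[OF cls_hom] by simp

lemma cls_surj:
  assumes "x \<in> carrier (UB2 r s)"
  obtains p where "x = cls r s p"
  using assms by (auto simp: UB2_def FactRing_def A_RCOSETS_def' cls_def)

lemma cls_rel: "p \<in> rel_ideal r s \<Longrightarrow> cls r s p = cls r s 0"
proof -
  interpret ideal "rel_ideal r s" free_ring by (rule ideal_rel_ideal)
  show "p \<in> rel_ideal r s \<Longrightarrow> cls r s p = cls r s 0"
    using a_rcos_const additive_subgroup.zero_closed[OF additive_subgroup_axioms]
    unfolding cls_def by simp
qed

lemma rel_mem: "rel1 r s \<in> rel_ideal r s" "rel2 r s \<in> rel_ideal r s"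
  using ring.genideal_self[OF ring_free_ring, of "{rel1 r s, rel2 r s}"]
  by (auto simp: rel_ideal_def)

lemma (in right_module) act_nat_pow:
  assumes "v \<in> V" "x \<in> carrier U"
  shows "v \<triangleleft> (x [^] (n::nat)) = ((\<lambda>w. w \<triangleleft> x) ^^ n) v"
  by (induction n) (simp_all add: act_one act_mult assms)

section \<open>From modules over the presented algebra to operators\<close>

locale ub2_module =
  fixes r s :: complex and act :: "'v::ab_group_add \<Rightarrow> free_alg set \<Rightarrow> 'v"
  assumes module: "right_module (UB2 r s) UNIV act"
begin

definition A where "A v p = act v (cls r s p)"

text \<open>The module is given as an abelian group only. Its complex structure is that of the
  scalars of the algebra, which act linearly because they are central
  (\<open>fscal_commute\<close>).\<close>

definition smul :: "complex \<Rightarrow> 'v \<Rightarrow> 'v" (infixr \<open>*s\<close> 75) where "c *s v = A v (fscal c)"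

lemma A_add_left: "A (v + w) p = A v p + A w p"
  and A_add: "A v (p + q) = A v p + A v q"
  and A_mult: "A v (p * q) = A (A v p) q"
  and A_one: "A v 1 = v"
  unfolding A_def cls_add cls_mult cls_one
  by (auto intro: right_module.act_add_left[OF module] right_module.act_add_right[OF module]
      right_module.act_mult[OF module] right_module.act_one[OF module] cls_carrier)

lemma A_zero: "A v 0 = 0"
  using A_add[of v 0 0] by simp

lemma A_diff: "A v (p - q) = A v p - A v q"
  using A_add[of v "p - q" q] by (simp add: eq_diff_eq)

lemma A_rel: "p \<in> rel_ideal r s \<Longrightarrow> A v p = 0"
  using A_zero[of v] by (simp add: A_def cls_rel)

lemma A_smul: "A (c *s v) p = c *s A v p"
  unfolding smul_def A_mult[symmetric] by (simp add: fscal_commute)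

sublocale complex_vs smul
proof unfold_locales
  fix a b v w
  show "a *s (v + w) = a *s v + a *s w" by (simp add: smul_def A_add_left)
  show "(a + b) *s v = a *s v + b *s v" by (simp add: smul_def A_add fscal_add)
  show "a *s b *s v = (a * b) *s v"
    by (simp only: smul_def A_mult mult.commute[of a b] fscal_mult)
  show "1 *s v = v" by (simp add: smul_def fscal_1 A_one)
qed

lemma lin_A: "lin (\<lambda>v. A v p)"
  by (rule linI) (simp_all add: A_add_left A_smul)

lemma A_fscal: "A v (fscal c) = c *s v"
  by (simp add: smul_def)

lemma A_cube: "A v (p ^ 3) = A (A (A v p) p) p"
  by (simp add: power3_eq_cube A_mult)

lemma A_square: "A v (p ^ 2) = A (A v p) p"
  by (simp add: power2_eq_square A_mult)

lemmas A_simps = A_add A_diff A_mult A_fscal A_smul A_cube A_square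

text \<open>Every element is a sum of scalar multiples of words, so invariance under the two
  generators makes a subspace a submodule.\<close>

lemma act_mem_subspace:
  assumes W: "subspace W" "\<And>v. v \<in> W \<Longrightarrow> A v f1 \<in> W" "\<And>v. v \<in> W \<Longrightarrow> A v f2 \<in> W" "v \<in> W"
  shows "A v p \<in> W"
  using \<open>v \<in> W\<close>
proof (induction p arbitrary: v rule: free_alg_induct)
  case (single k c)
  have "A v (Poly_Mapping.single (Word gs) 1) \<in> W" if "v \<in> W" for gs v
    using that
  proof (induction gs arbitrary: v)
    case Nil
    have "Poly_Mapping.single (Word []) 1 = (1 :: free_alg)"
      by (simp flip: zero_word_def)
    then show ?case using Nil by (simp add: A_one)
  next
    case (Cons g gs)
    have "A v (Poly_Mapping.single (Word [g]) 1) \<in> W"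
      using W(2,3) Cons.prems by (cases g) (auto simp: f1_def f2_def)
    then show ?case using Cons.IH by (subst single_Word_Cons) (simp add: A_mult)
  qed
  then show ?case using single W(1)
    by (subst single_eq_fscal_mult, cases k) (simp add: A_mult A_fscal subspace_scale)
qed (simp add: A_add subspace_add[OF W(1)])

definition "x1 v = A v f1"
definition "x2 v = A v (f12 r)"
definition "x3 v = A v (f2 * f12 r - fscal (s powi (-2)) * f12 r * f2)"
definition "x4 v = A v f2"

lemma act_X: "act v (X1 r s) = x1 v" "act v (X2 r s) = x2 v" "act v (X3 r s) = x3 v" "act v (X4 r s) = x4 v"
  by (simp_all add: X1_def X2_def X3_def X4_def x1_def x2_def x3_def x4_def A_def)

lemma act_scal: "act v (scal r s c) = c *s v"
  by (simp add: scal_def smul_def A_def)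

lemma lin_x: "lin x1" "lin x2" "lin x3" "lin x4"
  using lin_A[of f1] lin_A[of "f12 r"] lin_A[of f2]
    lin_A[of "f2 * f12 r - fscal (s powi (-2)) * f12 r * f2"]
  unfolding x1_def[abs_def] x2_def[abs_def] x3_def[abs_def] x4_def[abs_def] by blast+

lemmas xlin = lin_simps[OF lin_x(1)] lin_simps[OF lin_x(2)] lin_simps[OF lin_x(3)] lin_simps[OF lin_x(4)]

section \<open>The commutation relations derived from the two defining relations\<close>

lemma x2_eq: "x2 v = x4 (x1 v) - r^2 *s x1 (x4 v)"
  by (simp add: x2_def x1_def x4_def f12_def A_simps)

lemma x3_eq: "x3 v = x2 (x4 v) - inverse (s^2) *s x4 (x2 v)"
  by (simp add: x3_def x2_def x4_def A_simps power_int_minus)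

lemma rel1_eq: "x4 (x1 (x1 v)) = (r^2 + s^2) *s x1 (x4 (x1 v)) - (r^2 * s^2) *s x1 (x1 (x4 v))"
proof -
  have "x4 (x1 (x1 v)) - (r^2 + s^2) *s x1 (x4 (x1 v)) + (r^2 * s^2) *s x1 (x1 (x4 v)) = 0"
    using A_rel[OF rel_mem(1), of v] unfolding rel1_def x1_def x4_def by (simp only: A_simps)
  moreover have "a = b - c" if "a - b + c = 0" for a b c :: 'v
  proof -
    have "a - (b - c) = 0" using that by (simp add: algebra_simps)
    then show ?thesis by simp
  qed
  ultimately show ?thesis by blast
qed

lemma rel2_eq: "x4 (x4 (x4 (x1 v))) = (r^2 + r * s + s^2) *s x4 (x4 (x1 (x4 v)))
    - (r * s * (r^2 + r * s + s^2)) *s x4 (x1 (x4 (x4 v))) + (r^3 * s^3) *s x1 (x4 (x4 (x4 v)))"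
proof -
  have "x4 (x4 (x4 (x1 v))) - (r^2 + r * s + s^2) *s x4 (x4 (x1 (x4 v)))
    + (r * s * (r^2 + r * s + s^2)) *s x4 (x1 (x4 (x4 v))) - (r^3 * s^3) *s x1 (x4 (x4 (x4 v))) = 0"
    using A_rel[OF rel_mem(2), of v] unfolding rel2_def x1_def x4_def by (simp only: A_simps)
  moreover have "a = b - c + d" if "a - b + c - d = 0" for a b c d :: 'v
  proof -
    have "a - (b - c + d) = 0" using that by (simp add: algebra_simps)
    then show ?thesis by simp
  qed
  ultimately show ?thesis by blast
qed

lemma rel_12: "x2 (x1 v) = s^2 *s x1 (x2 v)"
  by (simp add: x2_eq rel1_eq xlin scale_left_distrib scale_right_diff_distrib algebra_simps)

lemma rel_14: "x4 (x1 v) = r^2 *s x1 (x4 v) + x2 v"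
  by (simp add: x2_eq)

lemma rel_24: "s \<noteq> 0 \<Longrightarrow> x4 (x2 v) = s^2 *s x2 (x4 v) - s^2 *s x3 v"
  by (simp add: x3_eq scale_right_diff_distrib)

lemma rel_13: "s \<noteq> 0 \<Longrightarrow> x3 (x1 v) = (r^2 * s^2) *s x1 (x3 v)"
  by (simp add: x3_eq rel_14 rel_12 xlin scale_right_diff_distrib scale_right_distrib)

text \<open>This is the second defining relation. It removes the monomial with all three
  \<open>x4\<close> outermost, and the coefficients of the other three are compared.\<close>

lemma rel_34:
  assumes s: "s \<noteq> 0"
  shows "x4 (x3 v) = (r * s) *s x3 (x4 v)"
proof -
  define T2 T3 T4 where T: "T2 = x4 (x4 (x1 (x4 v)))" "T3 = x4 (x1 (x4 (x4 v)))" "T4 = x1 (x4 (x4 (x4 v)))"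
  define i where "i = inverse (s^2)"
  have i_s: "i * s^2 = 1" using s by (simp add: i_def)
  have "x4 (x3 v) = (1 + i * r^2 - i * (r^2 + r * s + s^2)) *s T2
      + (- (r^2) + i * (r * s * (r^2 + r * s + s^2))) *s T3 - (i * (r^3 * s^3)) *s T4"
    unfolding x3_eq x2_eq xlin rel2_eq T[symmetric] i_def[symmetric]
    by (simp add: scale_left_distrib scale_left_diff_distrib scale_right_diff_distrib
        scale_right_distrib) (simp add: algebra_simps)
  also have "1 + i * r^2 - i * (r^2 + r * s + s^2) = - (r * s * i)"
    using i_s by (simp add: algebra_simps)
  also have "- (r^2) + i * (r * s * (r^2 + r * s + s^2)) = r * s * (1 + i * r^2)"
  proof -
    have "i * (r * s * (r^2 + r * s + s^2)) = r * s * (i * r^2) + (i * s^2) * r^2 + r * s * (i * s^2)"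
      by (simp add: algebra_simps power2_eq_square)
    then show ?thesis using i_s by (simp add: algebra_simps)
  qed
  also have "i * (r^3 * s^3) = r * s * r^2"
  proof -
    have "i * (r^3 * s^3) = (i * s^2) * (r * s * r^2)"
      by (simp add: algebra_simps power2_eq_square power3_eq_cube)
    then show ?thesis using i_s by simp
  qed
  also have "(- (r * s * i)) *s T2 + (r * s * (1 + i * r^2)) *s T3 - (r * s * r^2) *s T4 = (r * s) *s x3 (x4 v)"
    unfolding x3_eq x2_eq xlin T[symmetric] i_def[symmetric]
    by (simp add: scale_left_distrib scale_left_diff_distrib scale_right_diff_distrib
        scale_right_distrib) (simp add: algebra_simps)
  finally show ?thesis .
qed

text \<open>The product X_1 X_3 X_4 is rearranged in two ways. The terms in
  \<open>x1 (x3 (x4 v))\<close> cancel, and what is left is the claim times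
  \<open>r * s\<close>.\<close>

lemma rel_23:
  assumes "r \<noteq> 0" "s \<noteq> 0"
  shows "x3 (x2 v) = (r * s) *s x2 (x3 v)"
proof -
  have 1: "x4 (x3 (x1 v)) = (r^2 * s^2 * r^2 * (r * s)) *s x1 (x3 (x4 v)) + (r^2 * s^2) *s x2 (x3 v)"
    using assms by (simp add: rel_13 xlin rel_14 rel_34 scale_right_distrib mult_ac)
  have "x4 (x3 (x1 v)) = (r * s) *s x3 (x4 (x1 v))" by (rule rel_34[OF assms(2)])
  also have "\<dots> = (r^2 * s^2 * r^2 * (r * s)) *s x1 (x3 (x4 v)) + (r * s) *s x3 (x2 v)"
    using assms by (simp add: rel_14 xlin rel_13 scale_right_distrib mult_ac)
  finally have 2: "x4 (x3 (x1 v)) = (r^2 * s^2 * r^2 * (r * s)) *s x1 (x3 (x4 v)) + (r * s) *s x3 (x2 v)" .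
  have "(r * s) *s x3 (x2 v) = (r^2 * s^2) *s x2 (x3 v)"
    using trans[OF 2[symmetric] 1] by simp
  also have "r^2 * s^2 = (r * s) * (r * s)" by (simp add: power2_eq_square mult_ac)
  finally have "(r * s) *s x3 (x2 v) = (r * s) *s (r * s) *s x2 (x3 v)" by (simp only: scale_scale)
  then show ?thesis using assms by (simp del: scale_scale)
qed

lemma torsion_iff: "x \<in> carrier (UB2 r s) \<Longrightarrow>
    torsion (UB2 r s) UNIV act x \<longleftrightarrow> (\<forall>v. \<exists>n. ((\<lambda>w. act w x) ^^ n) v = 0)"
  and torsionfree_iff: "x \<in> carrier (UB2 r s) \<Longrightarrow>
    torsionfree (UB2 r s) UNIV act x \<longleftrightarrow> (\<forall>v n. v \<noteq> 0 \<longrightarrow> ((\<lambda>w. act w x) ^^ n) v \<noteq> 0)"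
  unfolding torsion_def torsionfree_def by (auto simp: right_module.act_nat_pow[OF module])

lemma torsion_X:
  "torsion (UB2 r s) UNIV act (X1 r s) \<longleftrightarrow> (\<forall>v. \<exists>n. (x1 ^^ n) v = 0)"
  "torsion (UB2 r s) UNIV act (X2 r s) \<longleftrightarrow> (\<forall>v. \<exists>n. (x2 ^^ n) v = 0)"
  "torsionfree (UB2 r s) UNIV act (X2 r s) \<longleftrightarrow> (\<forall>v n. v \<noteq> 0 \<longrightarrow> (x2 ^^ n) v \<noteq> 0)"
  "torsionfree (UB2 r s) UNIV act (X3 r s) \<longleftrightarrow> (\<forall>v n. v \<noteq> 0 \<longrightarrow> (x3 ^^ n) v \<noteq> 0)"
proof -
  have "X1 r s \<in> carrier (UB2 r s)" "X2 r s \<in> carrier (UB2 r s)" "X3 r s \<in> carrier (UB2 r s)"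
    by (simp_all add: X1_def X2_def X3_def cls_carrier)
  then show
    "torsion (UB2 r s) UNIV act (X1 r s) \<longleftrightarrow> (\<forall>v. \<exists>n. (x1 ^^ n) v = 0)"
    "torsion (UB2 r s) UNIV act (X2 r s) \<longleftrightarrow> (\<forall>v. \<exists>n. (x2 ^^ n) v = 0)"
    "torsionfree (UB2 r s) UNIV act (X2 r s) \<longleftrightarrow> (\<forall>v n. v \<noteq> 0 \<longrightarrow> (x2 ^^ n) v \<noteq> 0)"
    "torsionfree (UB2 r s) UNIV act (X3 r s) \<longleftrightarrow> (\<forall>v n. v \<noteq> 0 \<longrightarrow> (x3 ^^ n) v \<noteq> 0)"
    by (simp_all add: torsion_iff torsionfree_iff act_X)
qed

text \<open>The action on coordinates is defined by transport along the coordinate map, so the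
  module axioms of M(\<nu>) and M(\<xi>) hold automatically and only the prescribed formulas have to
  be read off.\<close>

lemma coord_transport:
  fixes e :: "'i \<Rightarrow> 'v"
  assumes fin: "finite I"
    and ind: "\<forall>c. (\<Sum>i\<in>I. c i *s e i) = 0 \<longrightarrow> (\<forall>i\<in>I. c i = 0)"
    and span: "span (e ` I) = UNIV"
  obtains \<phi> :: "'v \<Rightarrow> 'i \<Rightarrow> complex" and actM where "coord_module r s I actM"
    and "module_isomorphic (UB2 r s) UNIV act (coord_space I) actM"
    and "\<And>i. i \<in> I \<Longrightarrow> \<phi> (e i) = ebas i"
    and "\<And>i x. i \<in> I \<Longrightarrow> actM (ebas i) x = \<phi> (act (e i) x)"
    and "\<And>v w. \<phi> (v - w) = \<phi> v - \<phi> w" and "\<And>c v. \<phi> (c *s v) = c \<cdot>\<^sub>c \<phi> v"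
proof -
  define \<psi> where "\<psi> u = (\<Sum>i\<in>I. u i *s e i)" for u :: "'i \<Rightarrow> complex"
  let ?V = "coord_space I"
  have \<psi>_add: "\<psi> (u + w) = \<psi> u + \<psi> w" and \<psi>_scale: "\<psi> (c \<cdot>\<^sub>c u) = c *s \<psi> u"
    and \<psi>_diff: "\<psi> (u - w) = \<psi> u - \<psi> w" for u w c
    by (simp_all add: \<psi>_def scale_left_distrib sum.distrib cscale_def scale_sum_right
        scale_left_diff_distrib sum_subtractf)
  have \<psi>_e: "\<psi> (ebas i) = e i" if "i \<in> I" for i
  proof -
    have "\<psi> (ebas i) = (\<Sum>j\<in>I. if j = i then e j else 0)"
      unfolding \<psi>_def ebas_def by (intro sum.cong) auto
    then show ?thesis using that fin by simp
  qed
  have V_closed: "u + w \<in> ?V" "c \<cdot>\<^sub>c u \<in> ?V" "u - w \<in> ?V" "0 \<in> ?V" "- u \<in> ?V"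
    if "u \<in> ?V" "w \<in> ?V" for u w c
    using that by (simp_all add: coord_space_def cscale_def)
  have ebas_V: "ebas i \<in> ?V" if "i \<in> I" for i
    using that by (auto simp: coord_space_def ebas_def)
  have inj: "inj_on \<psi> ?V"
  proof (rule inj_onI)
    fix u w assume uw: "u \<in> ?V" "w \<in> ?V" "\<psi> u = \<psi> w"
    then have "\<psi> (u - w) = 0" by (simp add: \<psi>_diff)
    then have "(u - w) i = 0" if "i \<in> I" for i
      using ind[rule_format, of "u - w" i] that by (simp add: \<psi>_def)
    then have "u i = w i" for i
      using uw by (cases "i \<in> I") (auto simp: coord_space_def)
    then show "u = w" by (rule ext)
  qed
  have "\<psi> ` ?V = UNIV"
  proof -
    have "0 = \<psi> 0" by (simp add: \<psi>_def)
    moreover have "0 \<in> ?V" by (simp add: coord_space_def)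
    ultimately have "subspace (\<psi> ` ?V)"
      unfolding subspace_def
      by (auto simp: V_closed simp flip: \<psi>_add \<psi>_scale)
    moreover have "e ` I \<subseteq> \<psi> ` ?V" using \<psi>_e ebas_V by (metis image_subset_iff rev_image_eqI)
    ultimately show ?thesis using span_minimal span by blast
  qed
  then have bij: "bij_betw \<psi> ?V UNIV" using inj by (simp add: bij_betw_def)
  define \<phi> where "\<phi> = inv_into ?V \<psi>"
  have \<psi>\<phi>: "\<psi> (\<phi> v) = v" and \<phi>_mem: "\<phi> v \<in> ?V" for v
    using bij unfolding \<phi>_def by (simp_all add: bij_betw_inv_into_right bij_betw_def inv_into_into)
  have \<phi>\<psi>: "\<phi> (\<psi> u) = u" if "u \<in> ?V" for u
    using bij that unfolding \<phi>_def by (simp add: bij_betw_inv_into_left)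
  have \<phi>_add: "\<phi> (v + w) = \<phi> v + \<phi> w" and \<phi>_scale: "\<phi> (c *s v) = c \<cdot>\<^sub>c \<phi> v"
    and \<phi>_diff: "\<phi> (v - w) = \<phi> v - \<phi> w" for v w c
    using \<phi>\<psi>[of "\<phi> v + \<phi> w"] \<phi>\<psi>[of "c \<cdot>\<^sub>c \<phi> v"] \<phi>\<psi>[of "\<phi> v - \<phi> w"]
    by (simp_all add: \<psi>_add \<psi>_scale \<psi>_diff \<psi>\<phi> V_closed[OF \<phi>_mem \<phi>_mem])
  define actM where "actM u x = \<phi> (act (\<psi> u) x)" for u x
  have "right_module (UB2 r s) ?V actM"
    using ring_UB2
    by (intro right_module.intro right_module_axioms.intro)
      (simp_all add: V_closed \<phi>_mem actM_def \<psi>_add \<psi>\<phi> \<phi>_add[symmetric] \<phi>\<psi>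
        right_module.act_add_left[OF module] right_module.act_add_right[OF module]
        right_module.act_mult[OF module] right_module.act_one[OF module],
       auto simp: coord_space_def)
  then have "coord_module r s I actM"
    by (simp add: coord_module_def actM_def act_scal \<phi>_scale \<phi>\<psi>)
  moreover have "module_isomorphic (UB2 r s) UNIV act ?V actM"
    unfolding module_isomorphic_def
    by (rule exI[of _ \<phi>]) (use bij_betw_inv_into[OF bij] in \<open>auto simp: \<phi>_add actM_def \<psi>\<phi> simp flip: \<phi>_def\<close>)
  moreover have "\<phi> (e i) = ebas i" if "i \<in> I" for i
    using \<phi>\<psi>[OF ebas_V[OF that]] \<psi>_e[OF that] by simp
  moreover have "actM (ebas i) x = \<phi> (act (e i) x)" if "i \<in> I" for i x
    using \<psi>_e[OF that] by (simp add: actM_def)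
  ultimately show ?thesis using that \<phi>_diff \<phi>_scale by blast
qed

end

section \<open>Simple modules and the two isomorphisms\<close>

locale simple_ub2_module = ub2_module r s act
  for r s :: complex and act :: "'v::ab_group_add \<Rightarrow> free_alg set \<Rightarrow> 'v" +
  assumes r_nz: "r \<noteq> 0" and s_nz: "s \<noteq> 0"
    and r_root: "root_of_unity r" and s_root: "root_of_unity s" and r2_neq: "r^2 \<noteq> s^2"
    and simple_module: "simple_right_module (UB2 r s) UNIV act"
begin

lemma invariant_subspace_trivial:
  assumes W: "subspace W" "\<And>v. v \<in> W \<Longrightarrow> x1 v \<in> W" "\<And>v. v \<in> W \<Longrightarrow> x4 v \<in> W"
  shows "W = {0} \<or> W = UNIV"
proof -
  have "act v x \<in> W" if "v \<in> W" "x \<in> carrier (UB2 r s)" for v x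
    using that act_mem_subspace[of W v] W unfolding x1_def x4_def
    by (metis A_def cls_surj)
  then have "right_module (UB2 r s) W act"
    using ring_UB2 W(1)
    by (intro right_module.intro right_module_axioms.intro)
      (simp_all add: subspace_0 subspace_add subspace_neg
        right_module.act_add_left[OF module] right_module.act_add_right[OF module]
        right_module.act_mult[OF module] right_module.act_one[OF module])
  then show ?thesis using simple_module unfolding simple_right_module_def by blast
qed

sublocale b2_rep smul r s x1 x2 x3 x4
proof (intro b2_rep.intro b2_rep_axioms.intro)
  show "\<exists>v::'v. v \<noteq> 0" using simple_module unfolding simple_right_module_def by blast
qed (fact complex_vs_axioms r_nz s_nz r_root s_root r2_neq lin_x rel_12 rel_14 rel_13[OF s_nz]
    rel_24[OF s_nz] rel_34[OF s_nz] rel_23[OF r_nz s_nz]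
    | rule invariant_subspace_trivial, assumption, assumption, assumption)+

lemma M_xi_isomorphic:
  assumes tors1: "\<And>v. \<exists>n. (x1 ^^ n) v = 0" and tors2: "\<And>v. \<exists>n. (x2 ^^ n) v = 0"
    and tf3: "\<And>v n. v \<noteq> 0 \<Longrightarrow> (x3 ^^ n) v \<noteq> 0"
  shows "\<exists>\<xi>1 \<xi>2 actM. \<xi>1 \<noteq> 0 \<and> is_M_xi r s \<xi>1 \<xi>2 actM \<and>
    module_isomorphic (UB2 r s) UNIV act (coord_space {..<ell4 r s \<xi>2}) actM"
proof (rule xi_basis[OF tors1 tors2 tf3])
  fix \<xi>1 \<xi>2 :: complex and e :: "nat \<Rightarrow> 'v"
  assume \<xi>1: "\<xi>1 \<noteq> 0"
    and ind: "\<forall>c. (\<Sum>a<ell4 r s \<xi>2. c a *s e a) = 0 \<longrightarrow> (\<forall>a\<in>{..<ell4 r s \<xi>2}. c a = 0)"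
    and span: "span (e ` {..<ell4 r s \<xi>2}) = UNIV"
    and E1: "\<And>a. x1 (e a) = (g a * \<xi>1) *s e (a - 2)"
    and E2: "\<And>a. x2 (e a) = (d a * \<xi>1) *s e (a - 1)"
    and E3: "\<And>a. x3 (e a) = (inverse (r * s) ^ a * \<xi>1) *s e a"
    and E4: "\<And>a. x4 (e a) = e (Suc a)" and el: "e (ell4 r s \<xi>2) = \<xi>2 *s e 0" and l0: "ell4 r s \<xi>2 > 0"
  let ?l = "ell4 r s \<xi>2"
  show ?thesis
  proof (rule coord_transport[OF finite_lessThan ind span])
    fix \<phi> :: "'v \<Rightarrow> nat \<Rightarrow> complex" and actM
    assume M: "coord_module r s {..<?l} actM"
      and iso: "module_isomorphic (UB2 r s) UNIV act (coord_space {..<?l}) actM"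
      and \<phi>e: "\<And>a. a \<in> {..<?l} \<Longrightarrow> \<phi> (e a) = ebas a"
      and actM: "\<And>a x. a \<in> {..<?l} \<Longrightarrow> actM (ebas a) x = \<phi> (act (e a) x)"
      and \<phi>: "\<And>v w. \<phi> (v - w) = \<phi> v - \<phi> w" "\<And>c v. \<phi> (c *s v) = c \<cdot>\<^sub>c \<phi> v"
    have \<phi>0: "\<phi> 0 = 0" using \<phi>(1)[of 0 0] by simp
    have "is_M_xi r s \<xi>1 \<xi>2 actM"
      unfolding is_M_xi_def Let_def
    proof (intro conjI allI impI M, goal_cases)
      case (1 a)
      show ?case
      proof (cases "a = 0 \<or> a = 1")
        case True
        \<comment> \<open>The coefficient vanishes, so the truncated index \<open>a - 2\<close> does
          not matter.\<close>
        then have "g a = 0" by (auto simp: g_0 g_1)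
        then show ?thesis using 1 True by (auto simp: actM act_X E1 \<phi>0)
      next
        case False
        then show ?thesis using 1 by (simp add: actM act_X E1 \<phi> \<phi>e) (simp add: g_def q_def)
      qed
    next
      case (2 a)
      show ?case
      proof (cases "a = 0")
        case True
        then show ?thesis using 2 by (simp add: actM act_X E2 d_0 \<phi>0)
      next
        case False
        then show ?thesis using 2 by (simp add: actM act_X E2 \<phi> \<phi>e) (simp add: d_def q_def)
      qed
    next
      case (3 a)
      then show ?case by (simp add: actM act_X E3 \<phi> \<phi>e power_int_minus power_inverse del: inverse_mult_distrib)
    next
      case (4 a)
      show ?case
      proof (cases "a = ?l - 1")
        case True
        then show ?thesis using 4 l0 el by (simp add: actM act_X E4 \<phi> \<phi>e)
      next
        case False
        then show ?thesis using 4 by (simp add: actM act_X E4 \<phi>e)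
      qed
    qed
    then show ?thesis using \<xi>1 iso by blast
  qed
qed

lemma M_nu_isomorphic:
  assumes tors1: "\<And>v. \<exists>n. (x1 ^^ n) v = 0"
    and tf2: "\<And>v n. v \<noteq> 0 \<Longrightarrow> (x2 ^^ n) v \<noteq> 0"
    and tf3: "\<And>v n. v \<noteq> 0 \<Longrightarrow> (x3 ^^ n) v \<noteq> 0"
  shows "\<exists>\<nu>1 \<nu>2 \<nu>3 actM. \<nu>1 \<noteq> 0 \<and> \<nu>2 \<noteq> 0 \<and> is_M_nu r s \<nu>1 \<nu>2 \<nu>3 actM \<and>
    module_isomorphic (UB2 r s) UNIV act (coord_space (index_nu r s \<nu>3)) actM"
proof (rule nu_basis[OF tors1 tf2 tf3])
  fix \<nu>1 \<nu>2 \<nu>3 :: complex and e :: "nat \<times> nat \<Rightarrow> 'v"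
  assume \<nu>: "\<nu>1 \<noteq> 0" "\<nu>2 \<noteq> 0"
    and ind: "\<forall>c. (\<Sum>p\<in>index_nu r s \<nu>3. c p *s e p) = 0 \<longrightarrow> (\<forall>p\<in>index_nu r s \<nu>3. c p = 0)"
    and span: "span (e ` index_nu r s \<nu>3) = UNIV"
    and E1: "\<And>a b. x1 (e (a, b)) = (- (inverse (r^2) * k * C b) * \<nu>1^2) *s e (a + 2, b - 1)"
    and E2: "\<And>a b. x2 (e (a, b)) = (inverse (s^2) ^ b * \<nu>1) *s e (Suc a, b)"
    and E3: "\<And>a b. x3 (e (a, b)) = ((r * s) ^ a * \<nu>2) *s e (a, b)"
    and E4: "\<And>a b. x4 (e (Suc a, b)) = ((s^2) ^ b / k) *s
      (inverse \<nu>1 *s e (a, Suc b) - ((r * s) ^ a * inverse \<nu>1 * \<nu>2) *s e (a, b))"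
    and mod: "\<And>a b. e (a, b) = e (a mod ell3 r s, b)"
    and top: "\<And>a. e (a, m3 r s \<nu>3) = ((s^2) ^ (a * m3 r s \<nu>3) * \<nu>3) *s e (a, 0)"
    and sM: "(s^2) ^ (ell3 r s * m3 r s \<nu>3) * \<nu>3 = \<nu>3"
  let ?I = "index_nu r s \<nu>3" and ?l = "ell3 r s" and ?m = "m3 r s \<nu>3"
  have l0: "?l > 0" by (simp add: ell3_def mult_ord_pos[OF root_rs])
  have m0: "?m > 0" by (simp add: m3_eq mult_ord_pos[OF root_Q])
  have fin: "finite ?I" by (simp add: index_nu_def)
  show ?thesis
  proof (rule coord_transport[OF fin ind span])
    fix \<phi> :: "'v \<Rightarrow> nat \<times> nat \<Rightarrow> complex" and actM
    assume M: "coord_module r s ?I actM"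
      and iso: "module_isomorphic (UB2 r s) UNIV act (coord_space ?I) actM"
      and \<phi>e: "\<And>p. p \<in> ?I \<Longrightarrow> \<phi> (e p) = ebas p"
      and actM: "\<And>p x. p \<in> ?I \<Longrightarrow> actM (ebas p) x = \<phi> (act (e p) x)"
      and \<phi>: "\<And>v w. \<phi> (v - w) = \<phi> v - \<phi> w" "\<And>c v. \<phi> (c *s v) = c \<cdot>\<^sub>c \<phi> v"
    have \<phi>0: "\<phi> 0 = 0" using \<phi>(1)[of 0 0] by simp
    have inI: "(a, b) \<in> ?I \<longleftrightarrow> a < ?l \<and> b < ?m" for a b by (simp add: index_nu_def)
    have \<phi>_mod: "\<phi> (e (a, b)) = ebas (a mod ?l, b)" if "b < ?m" for a b
      using that l0 \<phi>e[of "(a mod ?l, b)"] mod[of a b] by (simp add: inI)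
    have shift_nat: "shift ?l a (int n) = (a + n) mod ?l" for a n
      by (simp add: shift_def nat_mod_distrib flip: of_nat_add of_nat_mod)
    have shift_pred: "shift ?l a (-1) = (a + ?l - 1) mod ?l" for a
    proof -
      have "(int a + - 1) mod int ?l = (int a + - 1 + int ?l) mod int ?l" by simp
      also have "int a + - 1 + int ?l = int (a + ?l - 1)" using l0 by simp
      finally show ?thesis unfolding shift_def by (simp flip: of_nat_mod)
    qed
    have "is_M_nu r s \<nu>1 \<nu>2 \<nu>3 actM"
      unfolding is_M_nu_def Let_def
    proof (intro conjI allI impI M, goal_cases)
      case (1 a b)
      show ?case
      proof (cases "b = 0")
        case True
        then show ?thesis using 1 by (simp add: actM inI act_X E1 C_0 \<phi>0)
      next
        case False
        have "inverse (r^2) * k = (r * s) powi (-2) * (1 - inverse r * s)"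
          using r0 s0 by (simp add: k_def power_int_minus power2_eq_square field_simps)
        then have coeff: "- (inverse (r^2) * k * C b) * \<nu>1^2 = - (s powi (-4 * (int b - 1))) * (r * s) powi (-2) * (1 - inverse r * s)
            * ((1 - (inverse r * s) ^ (2 * b)) / (1 - (inverse r * s)^2)) * \<nu>1^2"
          unfolding C_def by (simp add: mult_ac)
        have s2: "shift ?l a 2 = (a + 2) mod ?l" using shift_nat[of a 2] by simp
        have "b - 1 < ?m" using 1 by simp
        then have "actM (ebas (a, b)) (X1 r s) =
            (- (inverse (r^2) * k * C b) * \<nu>1^2) \<cdot>\<^sub>c ebas (shift ?l a 2, b - 1)"
          using 1 by (simp only: actM inI act_X E1 \<phi>(2) \<phi>_mod s2)
        then show ?thesis using False unfolding coeff by simp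
      qed
    next
      case (2 a b)
      have "s powi (-2 * int b) = inverse (s^2) ^ b"
        by (simp add: power_int_mult power_int_minus power_inverse)
      then show ?case using 2 shift_nat[of a 1] by (simp add: actM inI act_X E2 \<phi>(2) \<phi>_mod)
    next
      case (3 a b)
      then show ?case by (simp add: actM inI act_X E3 \<phi> \<phi>e)
    next
      case (4 a b)
      \<comment> \<open>A natural number representing the predecessor of \<open>a\<close> modulo
        \<open>?l\<close>.\<close>
      let ?a = "a + ?l - 1"
      have rs: "(r * s) ^ ?a = (r * s) powi (int a - 1)"
      proof -
        have "(r * s) ^ ?a * (r * s) = (r * s) ^ (a + ?l)" using l0 by (simp flip: power_Suc2)
        also have "\<dots> = (r * s) ^ a" using rs_l3 by (simp add: power_add ell3_def)
        finally show ?thesis using r0 s0 by (simp add: power_int_diff field_simps)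
      qed
      \<comment> \<open>The exponents for \<open>?a\<close> and for \<open>a - 1\<close> differ by
        the factor \<open>(s^2) ^ (?l * ?m)\<close>, which \<nu>3 absorbs by
        \<open>sM\<close>.\<close>
      have sa: "(s^2) ^ (?a * ?m) * \<nu>3 = s powi (2 * (int a - 1) * int ?m) * \<nu>3"
      proof -
        have "(s^2) ^ (?a * ?m) = s powi int (2 * (?a * ?m))" by (simp only: power_int_of_nat power_mult)
        also have "int (2 * (?a * ?m)) = 2 * (int a - 1) * int ?m + int (2 * (?l * ?m))"
        proof -
          have "int ?a = int a + int ?l - 1" using l0 by simp
          then show ?thesis by (simp only: of_nat_mult) (simp add: algebra_simps)
        qed
        also have "s powi \<dots> = s powi (2 * (int a - 1) * int ?m) * (s^2) ^ (?l * ?m)"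
          by (simp only: power_int_add[OF disjI1[OF s0]] power_int_of_nat power_mult)
        finally show ?thesis using sM by auto
      qed
      have "e (a, b) = e (Suc ?a, b)" using mod[of "Suc ?a" b] mod[of a b] l0 by simp
      then have "actM (ebas (a, b)) (X4 r s) = ((s^2) ^ b / k) \<cdot>\<^sub>c
         (inverse \<nu>1 \<cdot>\<^sub>c \<phi> (e (?a, Suc b)) - ((r * s) ^ ?a * inverse \<nu>1 * \<nu>2) \<cdot>\<^sub>c ebas (shift ?l a (-1), b))"
        using 4 by (simp only: actM inI act_X E4 \<phi> \<phi>_mod shift_pred)
      moreover have "inverse \<nu>1 \<cdot>\<^sub>c \<phi> (e (?a, Suc b)) = (if b \<noteq> ?m - 1 then inverse \<nu>1 \<cdot>\<^sub>c ebas (shift ?l a (-1), b + 1)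
        else (s powi (2 * (int a - 1) * int ?m) * inverse \<nu>1 * \<nu>3) \<cdot>\<^sub>c ebas (shift ?l a (-1), 0))"
      proof (cases "b = ?m - 1")
        case True
        then have "e (?a, Suc b) = ((s^2) ^ (?a * ?m) * \<nu>3) *s e (?a, 0)" using m0 top by simp
        then show ?thesis using True m0 unfolding sa
          by (simp add: \<phi>(2) \<phi>_mod shift_pred) (simp add: cscale_def fun_eq_iff)
      next
        case False
        then show ?thesis using 4 by (simp add: \<phi>_mod shift_pred)
      qed
      ultimately show ?case unfolding rs k_def by (simp add: power_mult)
    qed
    then show ?thesis using \<nu> iso by blast
  qed
qed

end

theorem theorem9p1:
  fixes r s :: complex
    and act :: "'v::ab_group_add \<Rightarrow> free_alg set \<Rightarrow> 'v"
  assumes "r \<noteq> 0" and "s \<noteq> 0"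
    and "root_of_unity r" and "root_of_unity s"
    and "r^2 \<noteq> s^2"
    and "simple_right_module (UB2 r s) (UNIV :: 'v set) act"
    and "torsion (UB2 r s) UNIV act (X1 r s)"
    and "torsionfree (UB2 r s) UNIV act (X3 r s)"
  shows "(torsionfree (UB2 r s) UNIV act (X2 r s) \<or> torsion (UB2 r s) UNIV act (X2 r s)) \<and>
    (torsionfree (UB2 r s) UNIV act (X2 r s) \<longrightarrow>
      (\<exists>\<nu>1 \<nu>2 \<nu>3 actM. \<nu>1 \<noteq> 0 \<and> \<nu>2 \<noteq> 0 \<and> is_M_nu r s \<nu>1 \<nu>2 \<nu>3 actM \<and>
        module_isomorphic (UB2 r s) UNIV act (coord_space (index_nu r s \<nu>3)) actM)) \<and>
    (torsion (UB2 r s) UNIV act (X2 r s) \<longrightarrow>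
      (\<exists>\<xi>1 \<xi>2 actM. \<xi>1 \<noteq> 0 \<and> is_M_xi r s \<xi>1 \<xi>2 actM \<and>
        module_isomorphic (UB2 r s) UNIV act (coord_space {..<ell4 r s \<xi>2}) actM))"
proof -
  interpret simple_ub2_module r s act
    by (intro simple_ub2_module.intro ub2_module.intro simple_ub2_module_axioms.intro)
      (use assms in \<open>simp_all add: simple_right_module_def\<close>)
  show ?thesis
    using torsion_dichotomy_x2 M_nu_isomorphic M_xi_isomorphic assms(7,8)
    unfolding torsion_X by (intro conjI impI) blast+
qed

end
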